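(* Let $\mathbf{N},\mathbf{M}$ be finitary structures (objects of $\mathfrak{M}_{\mathrm{fin}}$). Let $\hat h:\mathrm{Aut}(\mathbf{M})\twoheadrightarrow\mathrm{Aut}(\mathbf{N})$ be a surjective morphism of profinite groups and let $\hat g:\mathrm{Aut}(\mathbf{N})\hookrightarrow\mathrm{Aut}(\mathbf{M})$ be a section of $\hat h$, that is, $\hat h\circ\hat g=\mathrm{id}_{\mathrm{Aut}(\mathbf{N})}$. Then there is an interpretation-isomorphism $$i:\mathbf{N}\cong\mathbf{M}/A$$ for some $A\subset\mathbf{M}^{Eq}$ satisfying $\mathrm{dcl}_{\mathbf{M}^{Eq}}(A)=\mathrm{dcl}_{\mathbf{M}^{Eq}}([i\mathbf{N}])$ (so one may set $A=[i\mathbf{N}]$), such that $$M\subseteq\mathrm{dcl}_{\mathbf{M}^{Eq}}(iN\cup[i\mathbf{N}])\quad\text{and}\quad [i\mathbf{N}]\cap iN=\mathrm{dcl}_{\mathbf{N}}(\emptyset),$$ where $M,N$ are the universes of $\mathbf M,\mathbf N$ and $\mathrm{dcl}_{\mathbf N}(\emptyset)$ is regarded as a subset of $iN$ via $i$.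
   Context: Structures are multi-sorted $\mathcal{L}$-structures, for arbitrary languages $\mathcal{L}$. "Definable" means definable without parameters, and the default convention is that a relation is definable iff it is invariant under automorphisms. A definable sort in $\mathbf{M}$ is a set $D/E$ with $D$ a definable subset of a finite product of sorts and $E$ a definable equivalence relation on $D$. $\mathbf{M}^{Eq}$ is the structure interpretable in $\mathbf{M}$ having every sort $D/E$ of $\mathbf{M}$ as a definable substructure; automorphisms of $\mathbf M$ are identified with automorphisms of $\mathbf M^{Eq}$. $\mathbf{M}/A$ is the expansion of $\mathbf{M}$ by names for the elements of $A$. An interpretation (pre-morphism) $g:\mathbf{N}\to\mathbf{M}$ is an injective map $g:\mathbf{N}\to\mathbf{M}^{Eq}$ such that $g(N)$ is the universe of a sort in $\mathbf{M}^{Eq}$ and $g(R)$ is definable for each basic relation or operation $R$ of $\mathbf{N}$; $g(\mathbf N)$ is $g(N)$ with all the $g(R)$. It is an embedding if $g(\mathbf{N})$ has no proper expansion definable in $\mathbf{M}^{Eq}$, a surjection if $M\subseteq\mathrm{dcl}(g(N))$ ($\mathrm{dcl}$ in $\mathbf{M}^{Eq}$), and an isomorphism ($\mathbf N\cong\mathbf M$) if it is both. A structure is finitary if it is a union $\bigcup_{\alpha<\kappa}\mathbf{M}_\alpha$ of finite first-order $0$-definable substructures, equivalently $\mathbf{M}=\mathrm{acl}(\emptyset)$. For an interpretation $i$ of $\mathbf{N}$ in $\mathbf{M}$ over a parameter set $A$, put $\mathrm{Aut}(\mathbf{M}/[i\mathbf{N}]):=\{\sigma\in\mathrm{Aut}(\mathbf{M}^{Eq}):\sigma|_{i\mathbf{N}}\in\mathrm{Aut}(i\mathbf{N})\}$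 and $[i\mathbf{N}]:=\{a\in\mathbf{M}^{Eq}:\sigma(a)=a\ \text{for all}\ \sigma\in\mathrm{Aut}(\mathbf{M}/[i\mathbf{N}])\}$.
   Formalization: In [iN]∩iN, [iN] is formed in (M/A)^Eq (literal claim fails: N a point, M infinitely many 2-element sorts); M^Eq has labelled copies of its sorts; iN is an invariant subset that may cross sorts D/E, and D may mix sorts of M; universes are non-empty. *)

theory Defs
  imports "HOL-Analysis.Function_Topology" "HOL-Algebra.Bij"
begin

section \<open>Multi-sorted structures\<close>

text \<open>
  A structure carries its language: sorts, function symbols and relation symbols are arbitrary
  sets in arbitrary types. Constants are function symbols with empty argument list.
\<close>

record ('s, 'f, 'r) language =
  sorts :: "'s set"
  funs :: "'f set"
  rels :: "'r set"
  fun_dom :: "'f \<Rightarrow> 's list"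
  fun_cod :: "'f \<Rightarrow> 's"
  rel_dom :: "'r \<Rightarrow> 's list"

record ('s, 'f, 'r, 'a) mstruct = "('s, 'f, 'r) language" +
  sort_set :: "'s \<Rightarrow> 'a set"
  fun_int :: "'f \<Rightarrow> 'a list \<Rightarrow> 'a"
  rel_int :: "'r \<Rightarrow> 'a list set"

definition universe :: "('s, 'f, 'r, 'a) mstruct \<Rightarrow> 'a set" where
  "universe M = (\<Union>s\<in>sorts M. sort_set M s)"

definition sort_prod :: "('s, 'f, 'r, 'a) mstruct \<Rightarrow> 's list \<Rightarrow> 'a list set" where
  "sort_prod M ss = listset (map (sort_set M) ss)"

text \<open>As usual in first-order logic the universe is non-empty (single sorts may be empty).\<close>

definition is_structure :: "('s, 'f, 'r, 'a) mstruct \<Rightarrow> bool" where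
  "is_structure M \<longleftrightarrow>
     universe M \<noteq> {} \<and>
     disjoint_family_on (sort_set M) (sorts M) \<and>
     (\<forall>f\<in>funs M. set (fun_dom M f) \<subseteq> sorts M \<and> fun_cod M f \<in> sorts M \<and>
        (\<forall>xs\<in>sort_prod M (fun_dom M f). fun_int M f xs \<in> sort_set M (fun_cod M f))) \<and>
     (\<forall>r\<in>rels M. set (rel_dom M r) \<subseteq> sorts M \<and> rel_int M r \<subseteq> sort_prod M (rel_dom M r))"

definition fun_graph :: "('s, 'f, 'r, 'a) mstruct \<Rightarrow> 'f \<Rightarrow> 'a list set" where
  "fun_graph M f = {xs @ [fun_int M f xs] | xs. xs \<in> sort_prod M (fun_dom M f)}"

section \<open>First-order definability and finitary structures\<close>

datatype ('s, 'f) tm = Var "'s \<times> nat" | App 'f "('s, 'f) tm list"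

datatype ('s, 'f, 'r) fm =
    Eq "('s, 'f) tm" "('s, 'f) tm"
  | Rel 'r "('s, 'f) tm list"
  | Neg "('s, 'f, 'r) fm"
  | Conj "('s, 'f, 'r) fm" "('s, 'f, 'r) fm"
  | Ex "'s \<times> nat" "('s, 'f, 'r) fm"

primrec tm_fv :: "('s, 'f) tm \<Rightarrow> ('s \<times> nat) set" where
  "tm_fv (Var v) = {v}"
| "tm_fv (App f ts) = \<Union> (set (map tm_fv ts))"

primrec fm_fv :: "('s, 'f, 'r) fm \<Rightarrow> ('s \<times> nat) set" where
  "fm_fv (Eq t u) = tm_fv t \<union> tm_fv u"
| "fm_fv (Rel r ts) = \<Union> (set (map tm_fv ts))"
| "fm_fv (Neg \<phi>) = fm_fv \<phi>"
| "fm_fv (Conj \<phi> \<psi>) = fm_fv \<phi> \<union> fm_fv \<psi>"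
| "fm_fv (Ex v \<phi>) = fm_fv \<phi> - {v}"

inductive has_sort :: "('s, 'f, 'r, 'a) mstruct \<Rightarrow> ('s, 'f) tm \<Rightarrow> 's \<Rightarrow> bool"
  for M :: "('s, 'f, 'r, 'a) mstruct" where
  "fst v \<in> sorts M \<Longrightarrow> has_sort M (Var v) (fst v)"
| "f \<in> funs M \<Longrightarrow> list_all2 (has_sort M) ts (fun_dom M f) \<Longrightarrow>
     has_sort M (App f ts) (fun_cod M f)"

primrec well_sorted :: "('s, 'f, 'r, 'a) mstruct \<Rightarrow> ('s, 'f, 'r) fm \<Rightarrow> bool" where
  "well_sorted M (Eq t u) \<longleftrightarrow> (\<exists>s. has_sort M t s \<and> has_sort M u s)"
| "well_sorted M (Rel r ts) \<longleftrightarrow> r \<in> rels M \<and> list_all2 (has_sort M) ts (rel_dom M r)"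
| "well_sorted M (Neg \<phi>) \<longleftrightarrow> well_sorted M \<phi>"
| "well_sorted M (Conj \<phi> \<psi>) \<longleftrightarrow> well_sorted M \<phi> \<and> well_sorted M \<psi>"
| "well_sorted M (Ex v \<phi>) \<longleftrightarrow> fst v \<in> sorts M \<and> well_sorted M \<phi>"

primrec tm_val :: "('s, 'f, 'r, 'a) mstruct \<Rightarrow> ('s \<times> nat \<Rightarrow> 'a) \<Rightarrow> ('s, 'f) tm \<Rightarrow> 'a" where
  "tm_val M e (Var v) = e v"
| "tm_val M e (App f ts) = fun_int M f (map (tm_val M e) ts)"

primrec sat :: "('s, 'f, 'r, 'a) mstruct \<Rightarrow> ('s \<times> nat \<Rightarrow> 'a) \<Rightarrow> ('s, 'f, 'r) fm \<Rightarrow> bool" where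
  "sat M e (Eq t u) \<longleftrightarrow> tm_val M e t = tm_val M e u"
| "sat M e (Rel r ts) \<longleftrightarrow> map (tm_val M e) ts \<in> rel_int M r"
| "sat M e (Neg \<phi>) \<longleftrightarrow> \<not> sat M e \<phi>"
| "sat M e (Conj \<phi> \<psi>) \<longleftrightarrow> sat M e \<phi> \<and> sat M e \<psi>"
| "sat M e (Ex v \<phi>) \<longleftrightarrow> (\<exists>x\<in>sort_set M (fst v). sat M (e(v := x)) \<phi>)"

definition fo_definable_set :: "('s, 'f, 'r, 'a) mstruct \<Rightarrow> 'a set \<Rightarrow> bool" where
  "fo_definable_set M X \<longleftrightarrow>
     (\<exists>\<phi> v. fst v \<in> sorts M \<and> well_sorted M \<phi> \<and> fm_fv \<phi> \<subseteq> {v} \<and>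
        X = {x \<in> sort_set M (fst v). \<forall>e. sat M (e(v := x)) \<phi>})"

definition acl_empty :: "('s, 'f, 'r, 'a) mstruct \<Rightarrow> 'a set" where
  "acl_empty M = \<Union> {X. finite X \<and> fo_definable_set M X}"

definition finitary :: "('s, 'f, 'r, 'a) mstruct \<Rightarrow> bool" where
  "finitary M \<longleftrightarrow> universe M = acl_empty M"

section \<open>Automorphism groups\<close>

text \<open>Automorphisms are extensional functions on the universe, as in the theory Bij.\<close>

definition Aut :: "('s, 'f, 'r, 'a) mstruct \<Rightarrow> ('a \<Rightarrow> 'a) set" where
  "Aut M = {\<sigma> \<in> Bij (universe M).
     (\<forall>s\<in>sorts M. \<sigma> ` sort_set M s = sort_set M s) \<and>
     (\<forall>f\<in>funs M. \<forall>xs\<in>sort_prod M (fun_dom M f).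
        \<sigma> (fun_int M f xs) = fun_int M f (map \<sigma> xs)) \<and>
     (\<forall>r\<in>rels M. map \<sigma> ` rel_int M r = rel_int M r)}"

definition Aut_group :: "('s, 'f, 'r, 'a) mstruct \<Rightarrow> ('a \<Rightarrow> 'a) monoid" where
  "Aut_group M = (BijGroup (universe M))\<lparr>carrier := Aut M\<rparr>"

text \<open>
  The topology of pointwise convergence; for finitary structures it is the profinite topology.
\<close>

definition Aut_topology :: "('s, 'f, 'r, 'a) mstruct \<Rightarrow> ('a \<Rightarrow> 'a) topology" where
  "Aut_topology M =
     subtopology (product_topology (\<lambda>_. discrete_topology (universe M)) (universe M)) (Aut M)"

definition Aut_morphism ::
  "('s, 'f, 'r, 'a) mstruct \<Rightarrow> ('t, 'g, 'q, 'b) mstruct \<Rightarrow> (('a \<Rightarrow> 'a) \<Rightarrow> ('b \<Rightarrow> 'b)) \<Rightarrow> bool" where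
  "Aut_morphism M N h \<longleftrightarrow>
     h \<in> hom (Aut_group M) (Aut_group N) \<and> continuous_map (Aut_topology M) (Aut_topology N) h"

section \<open>Imaginaries\<close>

text \<open>
  An imaginary is a class of some \<open>D/E\<close>, a set of tuples, together with a label \<open>l\<close>. The labels
  provide copies of the sorts \<open>D/E\<close>: there are at most as many unlabelled classes as sets of finite
  tuples from \<open>M\<close>, whereas nothing bounds the cardinality of a structure \<open>N\<close> to be interpreted in
  \<open>M\<close> (already rigid \<open>N\<close> can be arbitrarily large while \<open>M\<close> is a single point).
\<close>

type_synonym ('l, 'a) imag = "'l \<times> 'a list set"

definition act :: "('a \<Rightarrow> 'a) \<Rightarrow> ('l, 'a) imag \<Rightarrow> ('l, 'a) imag" where
  "act \<sigma> = map_prod id ((`) (map \<sigma>))"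

text \<open>
  The automorphisms of \<open>M/A\<close>, the expansion of \<open>M\<close> by names for the imaginaries in \<open>A\<close>. In the
  definitions below a parameter set \<open>A\<close> always means that the notion is taken in \<open>M/A\<close>, and
  \<open>A = {}\<close> gives the notion for \<open>M\<close> itself.
\<close>

definition Aut_over :: "('s, 'f, 'r, 'a) mstruct \<Rightarrow> ('l, 'a) imag set \<Rightarrow> ('a \<Rightarrow> 'a) set" where
  "Aut_over M A = {\<sigma> \<in> Aut M. \<forall>a\<in>A. act \<sigma> a = a}"

text \<open>Definable means invariant under automorphisms.\<close>

definition definable ::
  "('s, 'f, 'r, 'a) mstruct \<Rightarrow> ('l, 'a) imag set \<Rightarrow> 'a list set \<Rightarrow> bool" where
  "definable M A R \<longleftrightarrow> (\<forall>\<sigma>\<in>Aut_over M A. map \<sigma> ` R = R)"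

definition definable_eqrel ::
  "('s, 'f, 'r, 'a) mstruct \<Rightarrow> ('l, 'a) imag set \<Rightarrow> ('a list \<times> 'a list) set \<Rightarrow> bool" where
  "definable_eqrel M A E \<longleftrightarrow> (\<forall>\<sigma>\<in>Aut_over M A. map_prod (map \<sigma>) (map \<sigma>) ` E = E)"

text \<open>
  \<open>D\<close> is a set of tuples of a fixed length from the whole universe. Being invariant, the universe is
  itself a definable sort, so \<open>D\<close> may meet several sorts of \<open>M\<close>.
\<close>

definition definable_sort ::
  "('s, 'f, 'r, 'a) mstruct \<Rightarrow> ('l, 'a) imag set \<Rightarrow> 'a list set \<Rightarrow> ('a list \<times> 'a list) set \<Rightarrow> bool"
where
  "definable_sort M A D E \<longleftrightarrow>
     (\<exists>k. D \<subseteq> {xs. set xs \<subseteq> universe M \<and> length xs = k}) \<and>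
     definable M A D \<and> equiv D E \<and> definable_eqrel M A E"

text \<open>The universe of \<open>(M/A)\<^sup>E\<^sup>q\<close>, with \<open>(M/{})\<^sup>E\<^sup>q = M\<^sup>E\<^sup>q\<close>.\<close>

definition Eq_univ :: "('s, 'f, 'r, 'a) mstruct \<Rightarrow> ('l, 'a) imag set \<Rightarrow> ('l, 'a) imag set" where
  "Eq_univ M A = {(l, C) | l C. \<exists>D E. definable_sort M A D E \<and> C \<in> D // E}"

text \<open>The elements of \<open>M\<close>, seen as imaginaries.\<close>

definition real_elements :: "('s, 'f, 'r, 'a) mstruct \<Rightarrow> ('l, 'a) imag set" where
  "real_elements M = {(l, {[m]}) | l m. m \<in> universe M}"

definition definable_Eq ::
  "('s, 'f, 'r, 'a) mstruct \<Rightarrow> ('l, 'a) imag set \<Rightarrow> ('l, 'a) imag list set \<Rightarrow> bool" where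
  "definable_Eq M A R \<longleftrightarrow> (\<forall>\<sigma>\<in>Aut_over M A. map (act \<sigma>) ` R = R)"

text \<open>Definable closure of \<open>X\<close> in \<open>(M/A)\<^sup>E\<^sup>q\<close>, and in \<open>M\<close> itself.\<close>

definition dcl_Eq ::
  "('s, 'f, 'r, 'a) mstruct \<Rightarrow> ('l, 'a) imag set \<Rightarrow> ('l, 'a) imag set \<Rightarrow> ('l, 'a) imag set" where
  "dcl_Eq M A X = {e \<in> Eq_univ M A.
     \<forall>\<sigma>\<in>Aut_over M A. (\<forall>x\<in>X. act \<sigma> x = x) \<longrightarrow> act \<sigma> e = e}"

definition dcl :: "('s, 'f, 'r, 'a) mstruct \<Rightarrow> 'a set \<Rightarrow> 'a set" where
  "dcl M X = {m \<in> universe M. \<forall>\<sigma>\<in>Aut M. (\<forall>x\<in>X. \<sigma> x = x) \<longrightarrow> \<sigma> m = m}"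

section \<open>Interpretations\<close>

text \<open>
  Interpretations of \<open>N\<close> in \<open>M/A\<close>. The image is a sort in the structure \<open>(M/A)\<^sup>E\<^sup>q\<close> in the sense of
  an invariant subset; it need not lie inside a single \<open>D/E\<close>.
\<close>

definition interpretation_over ::
  "('t, 'g, 'q, 'b) mstruct \<Rightarrow> ('s, 'f, 'r, 'a) mstruct \<Rightarrow> ('l, 'a) imag set \<Rightarrow>
   ('b \<Rightarrow> ('l, 'a) imag) \<Rightarrow> bool" where
  "interpretation_over N M A i \<longleftrightarrow>
     inj_on i (universe N) \<and> i ` universe N \<subseteq> Eq_univ M A \<and>
     definable_Eq M A {[i n] | n. n \<in> universe N} \<and>
     (\<forall>s\<in>sorts N. definable_Eq M A {[i n] | n. n \<in> sort_set N s}) \<and>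
     (\<forall>f\<in>funs N. definable_Eq M A (map i ` fun_graph N f)) \<and>
     (\<forall>r\<in>rels N. definable_Eq M A (map i ` rel_int N r))"

text \<open>
  No proper definable expansion: every relation on \<open>iN\<close> that is definable in \<open>(M/A)\<^sup>E\<^sup>q\<close> is
  already definable in \<open>N\<close>, without parameters.
\<close>

definition embedding_over ::
  "('t, 'g, 'q, 'b) mstruct \<Rightarrow> ('s, 'f, 'r, 'a) mstruct \<Rightarrow> ('l, 'a) imag set \<Rightarrow>
   ('b \<Rightarrow> ('l, 'a) imag) \<Rightarrow> bool" where
  "embedding_over N M A i \<longleftrightarrow> interpretation_over N M A i \<and>
     (\<forall>k. \<forall>R \<subseteq> {xs. set xs \<subseteq> universe N \<and> length xs = k}.
        definable_Eq M A (map i ` R) \<longrightarrow> (\<forall>\<tau>\<in>Aut N. map \<tau> ` R = R))"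

definition surjection_over ::
  "('t, 'g, 'q, 'b) mstruct \<Rightarrow> ('s, 'f, 'r, 'a) mstruct \<Rightarrow> ('l, 'a) imag set \<Rightarrow>
   ('b \<Rightarrow> ('l, 'a) imag) \<Rightarrow> bool" where
  "surjection_over N M A i \<longleftrightarrow> interpretation_over N M A i \<and>
     real_elements M \<subseteq> dcl_Eq M A (i ` universe N)"

definition isomorphism_over ::
  "('t, 'g, 'q, 'b) mstruct \<Rightarrow> ('s, 'f, 'r, 'a) mstruct \<Rightarrow> ('l, 'a) imag set \<Rightarrow>
   ('b \<Rightarrow> ('l, 'a) imag) \<Rightarrow> bool" where
  "isomorphism_over N M A i \<longleftrightarrow> embedding_over N M A i \<and> surjection_over N M A i"

text \<open>
  \<open>Aut(M/[iN])\<close>: the automorphisms of \<open>M\<close> that restrict to an automorphism of the structure \<open>iN\<close>,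
  that is, to \<open>i \<circ> \<tau> \<circ> i\<^sup>-\<^sup>1\<close> for some \<open>\<tau> \<in> Aut N\<close>.
\<close>

definition Aut_bracket ::
  "('t, 'g, 'q, 'b) mstruct \<Rightarrow> ('s, 'f, 'r, 'a) mstruct \<Rightarrow> ('b \<Rightarrow> ('l, 'a) imag) \<Rightarrow> ('a \<Rightarrow> 'a) set"
where
  "Aut_bracket N M i = {\<sigma> \<in> Aut M. \<exists>\<tau>\<in>Aut N. \<forall>n\<in>universe N. act \<sigma> (i n) = i (\<tau> n)}"

text \<open>
  \<open>[iN]\<close>, formed inside \<open>(M/A)\<^sup>E\<^sup>q\<close>; for \<open>A = {}\<close> it is the set \<open>[iN] \<subseteq> M\<^sup>E\<^sup>q\<close>. If \<open>i\<close> is an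
  interpretation in \<open>M/A\<close>, then \<open>iN\<close> is a subset of \<open>(M/A)\<^sup>E\<^sup>q\<close> and in general not of \<open>M\<^sup>E\<^sup>q\<close>, so
  \<open>[iN]\<close> can be intersected with \<open>iN\<close> only inside \<open>(M/A)\<^sup>E\<^sup>q\<close>.
\<close>

definition bracket ::
  "('t, 'g, 'q, 'b) mstruct \<Rightarrow> ('s, 'f, 'r, 'a) mstruct \<Rightarrow> ('l, 'a) imag set \<Rightarrow>
   ('b \<Rightarrow> ('l, 'a) imag) \<Rightarrow> ('l, 'a) imag set" where
  "bracket N M A i = {a \<in> Eq_univ M A. \<forall>\<sigma>\<in>Aut_bracket N M i. act \<sigma> a = a}"

end

(*
  The image K of g is the fixed-point set of the continuous retraction g o h, hence closed, and
  therefore the automorphism group of M over the set A of all imaginaries fixed by K. It remains to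
  find, for every n in N, an imaginary i(n) of M/A so that Aut N acts on the i(n) as on N and only
  elements of K act on iN as automorphisms of N; then A = [iN]. The class i(n) consists of the
  K-translates of tuples (a, x, y), where a is a tuple whose stabilizer in K is so small that it
  fixes n, and (x, y) ranges over a well-ordering of the universe. Since orbits are finite and a
  finite well-ordered set is rigid, the pairs (x, y) force an automorphism of M fixing all i(n) to
  agree with K on every finite set on which the stabilizer of some a is trivial. If a is made to
  depend on the orbit of n so as to exhaust all finite subsets of N, every finite set of M is of
  this kind.
*)

theory Submission
  imports Defs
begin

section \<open>Automorphisms\<close>

text \<open>The bracket is formed with all of \<open>Aut M\<close>, not only with the automorphisms
  over \<open>A\<close>, so the classes i(n) must by themselves single out K inside
  \<open>Aut M\<close>. Orbits of finite tuples cannot do this: if N is one point, then K is trivial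
  and so must be the stabilizer of the only class, while every finite tuple of an infinite M may
  have a non-trivial stabilizer. An ordering of the whole universe put into one class removes the
  obstacle. Such an infinite class is admissible because definable means invariant. The ordering
  need not be K-invariant; it is attached to one representative per orbit and carried along by K.
  What survives is its restriction to finite sets fixed pointwise by the stabilizer of a. The
  argument is therefore local: the correcting element of K depends on the finite set, and closedness
  of K supplies the limit. Both continuity assumptions enter the choice of a. Continuity of h gives
  an a whose stabilizer fixes prescribed points of N; continuity of g turns finitely many fixed
  points of N into a prescribed finite set of fixed points of M.\<close>

lemma sort_prod_eq:
  "sort_prod M ss = {xs. list_all2 (\<lambda>x s. x \<in> sort_set M s) xs ss}"
  unfolding sort_prod_def
proof (induction ss)
  case (Cons s ss)
  then show ?case
    by (auto simp: set_Cons_def list_all2_Cons2)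
qed simp

lemma sort_prod_subset_lists:
  assumes "set ss \<subseteq> sorts M"
  shows "sort_prod M ss \<subseteq> lists (universe M)"
proof
  fix xs assume "xs \<in> sort_prod M ss"
  then have "list_all2 (\<lambda>x s. x \<in> sort_set M s) xs ss"
    by (simp add: sort_prod_eq)
  then have "\<forall>x\<in>set xs. \<exists>s\<in>set ss. x \<in> sort_set M s"
    by (metis in_set_conv_nth list_all2_conv_all_nth)
  then show "xs \<in> lists (universe M)"
    using assms by (auto simp: universe_def)
qed

lemma sort_prod_map:
  assumes "set ss \<subseteq> sorts M" "\<And>s. s \<in> sorts M \<Longrightarrow> \<sigma> ` sort_set M s \<subseteq> sort_set M s"
    and "xs \<in> sort_prod M ss"
  shows "map \<sigma> xs \<in> sort_prod M ss"
proof -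
  have "list_all2 (\<lambda>x s. x \<in> sort_set M s) xs ss"
    using assms(3) by (simp add: sort_prod_eq)
  moreover have "set ss \<subseteq> sorts M \<Longrightarrow> list_all2 (\<lambda>x s. x \<in> sort_set M s) xs ss \<Longrightarrow>
      list_all2 (\<lambda>x s. \<sigma> x \<in> sort_set M s) xs ss"
    using assms(2) by (auto simp: list_all2_conv_all_nth image_subset_iff subset_iff)
  ultimately show ?thesis
    using assms(1) by (simp add: sort_prod_eq list_all2_map1)
qed

lemma is_structure_fun:
  assumes "is_structure M" "f \<in> funs M"
  shows "set (fun_dom M f) \<subseteq> sorts M" "fun_cod M f \<in> sorts M"
    and "xs \<in> sort_prod M (fun_dom M f) \<Longrightarrow> fun_int M f xs \<in> sort_set M (fun_cod M f)"
  using assms by (auto simp: is_structure_def)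

lemma is_structure_rel:
  assumes "is_structure M" "r \<in> rels M"
  shows "set (rel_dom M r) \<subseteq> sorts M" "rel_int M r \<subseteq> sort_prod M (rel_dom M r)"
  using assms by (auto simp: is_structure_def)

lemma rel_int_subset_lists:
  "is_structure M \<Longrightarrow> r \<in> rels M \<Longrightarrow> rel_int M r \<subseteq> lists (universe M)"
  using is_structure_rel sort_prod_subset_lists by fastforce

lemma AutD:
  assumes "\<sigma> \<in> Aut M"
  shows "\<sigma> \<in> Bij (universe M)"
    and "s \<in> sorts M \<Longrightarrow> \<sigma> ` sort_set M s = sort_set M s"
    and "f \<in> funs M \<Longrightarrow> xs \<in> sort_prod M (fun_dom M f) \<Longrightarrow>
      \<sigma> (fun_int M f xs) = fun_int M f (map \<sigma> xs)"
    and "r \<in> rels M \<Longrightarrow> map \<sigma> ` rel_int M r = rel_int M r"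
  using assms unfolding Aut_def by blast+

lemma Aut_bij_betw: "\<sigma> \<in> Aut M \<Longrightarrow> bij_betw \<sigma> (universe M) (universe M)"
  using AutD(1) by (auto simp: Bij_def)

lemma Aut_mem: "\<sigma> \<in> Aut M \<Longrightarrow> x \<in> universe M \<Longrightarrow> \<sigma> x \<in> universe M"
  using Aut_bij_betw bij_betwE by blast

lemma Aut_inj:
  "\<sigma> \<in> Aut M \<Longrightarrow> x \<in> universe M \<Longrightarrow> y \<in> universe M \<Longrightarrow> \<sigma> x = \<sigma> y \<longleftrightarrow> x = y"
  using Aut_bij_betw bij_betw_imp_inj_on inj_on_eq_iff by metis

lemma Aut_eqI:
  "\<sigma> \<in> Aut M \<Longrightarrow> \<rho> \<in> Aut M \<Longrightarrow> (\<And>x. x \<in> universe M \<Longrightarrow> \<sigma> x = \<rho> x) \<Longrightarrow> \<sigma> = \<rho>"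
  using AutD(1) Bij_imp_extensional extensionalityI by metis

section \<open>Identity, composition and inverses of automorphisms\<close>

lemma id_in_Aut: "is_structure M \<Longrightarrow> (\<lambda>x\<in>universe M. x) \<in> Aut M"
proof -
  assume M: "is_structure M"
  have map_id: "map (\<lambda>x\<in>universe M. x) xs = xs" if "xs \<in> lists (universe M)" for xs
    using that by (auto intro: map_idI)
  have sort: "(\<lambda>x\<in>universe M. x) ` sort_set M s = sort_set M s" if "s \<in> sorts M" for s
    using that by (auto simp: universe_def image_iff)
  have "(\<lambda>x\<in>universe M. x) (fun_int M f xs) = fun_int M f (map (\<lambda>x\<in>universe M. x) xs)"
    if "f \<in> funs M" "xs \<in> sort_prod M (fun_dom M f)" for f xs
  proof -
    have "fun_int M f xs \<in> universe M"
      using is_structure_fun[OF M that(1)] that(2) by (auto simp: universe_def)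
    moreover have "xs \<in> lists (universe M)"
      using sort_prod_subset_lists is_structure_fun(1)[OF M that(1)] that(2) by blast
    ultimately show ?thesis
      using map_id by simp
  qed
  moreover have "map (\<lambda>x\<in>universe M. x) ` rel_int M r = rel_int M r" if "r \<in> rels M" for r
    using rel_int_subset_lists[OF M that] map_id by (force simp: image_iff)
  ultimately show ?thesis
    using sort id_Bij by (auto simp: Aut_def)
qed

lemma map_compose:
  "xs \<in> lists U \<Longrightarrow> map (compose U \<sigma> \<rho>) xs = map \<sigma> (map \<rho> xs)"
  by (auto simp: compose_def)

lemma compose_in_Aut:
  assumes M: "is_structure M" and \<sigma>: "\<sigma> \<in> Aut M" and \<rho>: "\<rho> \<in> Aut M"
  shows "compose (universe M) \<sigma> \<rho> \<in> Aut M"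
proof -
  let ?c = "compose (universe M) \<sigma> \<rho>"
  have "?c ` sort_set M s = sort_set M s" if "s \<in> sorts M" for s
  proof -
    have "?c ` sort_set M s = \<sigma> ` \<rho> ` sort_set M s"
      using that by (auto simp: universe_def compose_def image_iff)
    then show ?thesis
      using AutD(2)[OF \<sigma> that] AutD(2)[OF \<rho> that] by simp
  qed
  moreover have "?c (fun_int M f xs) = fun_int M f (map ?c xs)"
    if f: "f \<in> funs M" and xs: "xs \<in> sort_prod M (fun_dom M f)" for f xs
  proof -
    have "fun_int M f xs \<in> universe M"
      using is_structure_fun[OF M f] xs by (auto simp: universe_def)
    moreover have "xs \<in> lists (universe M)"
      using sort_prod_subset_lists is_structure_fun(1)[OF M f] xs by blast
    moreover have "map \<rho> xs \<in> sort_prod M (fun_dom M f)"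
      using sort_prod_map[OF is_structure_fun(1)[OF M f] _ xs] AutD(2)[OF \<rho>] by blast
    ultimately show ?thesis
      unfolding map_compose[OF \<open>xs \<in> lists (universe M)\<close>]
      using AutD(3)[OF \<sigma> f] AutD(3)[OF \<rho> f xs] by (simp only: compose_eq)
  qed
  moreover have "map ?c ` rel_int M r = rel_int M r" if r: "r \<in> rels M" for r
  proof -
    have "map ?c ` rel_int M r = map \<sigma> ` map \<rho> ` rel_int M r"
      unfolding image_image
      by (intro image_cong refl map_compose subsetD[OF rel_int_subset_lists[OF M r]])
    then show ?thesis
      using AutD(4)[OF \<sigma> r] AutD(4)[OF \<rho> r] by simp
  qed
  ultimately show ?thesis
    using compose_Bij[OF AutD(1)[OF \<sigma>] AutD(1)[OF \<rho>]] by (auto simp: Aut_def)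
qed

lemma inverse_in_Aut:
  assumes M: "is_structure M" and \<sigma>: "\<sigma> \<in> Aut M"
  shows "(\<lambda>x\<in>universe M. inv_into (universe M) \<sigma> x) \<in> Aut M"
proof -
  let ?i = "\<lambda>x\<in>universe M. inv_into (universe M) \<sigma> x"
  have i_\<sigma>: "?i (\<sigma> x) = x" if "x \<in> universe M" for x
    using that Aut_mem[OF \<sigma>] Aut_bij_betw[OF \<sigma>] by (simp add: bij_betw_inv_into_left)
  have map_i_\<sigma>: "map ?i (map \<sigma> xs) = xs" if "xs \<in> lists (universe M)" for xs
    unfolding map_map o_def by (intro map_idI i_\<sigma>) (use that in auto)
  have sort: "?i ` sort_set M s = sort_set M s" if "s \<in> sorts M" for s
  proof -
    have "sort_set M s \<subseteq> universe M"
      using that by (auto simp: universe_def)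
    then have "?i ` \<sigma> ` sort_set M s = (\<lambda>x. x) ` sort_set M s"
      unfolding image_image by (intro image_cong refl i_\<sigma>) blast
    then show ?thesis
      using AutD(2)[OF \<sigma> that] by simp
  qed
  moreover have "?i (fun_int M f xs) = fun_int M f (map ?i xs)"
    if f: "f \<in> funs M" and xs: "xs \<in> sort_prod M (fun_dom M f)" for f xs
  proof -
    \<comment> \<open>Compatibility of the inverse with \<open>f\<close> is compatibility of
      \<sigma> with \<open>f\<close> at the pulled-back arguments.\<close>
    let ?ys = "map ?i xs"
    have ys: "?ys \<in> sort_prod M (fun_dom M f)"
      using sort_prod_map[OF is_structure_fun(1)[OF M f] _ xs] sort by blast
    have "xs \<in> lists (universe M)"
      using sort_prod_subset_lists is_structure_fun(1)[OF M f] xs by blast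
    then have "map \<sigma> ?ys = xs"
      unfolding map_map
      by (intro map_idI) (use Aut_bij_betw[OF \<sigma>] in \<open>auto simp: bij_betw_inv_into_right\<close>)
    then have "fun_int M f xs = \<sigma> (fun_int M f ?ys)"
      using AutD(3)[OF \<sigma> f ys] by simp
    moreover have "fun_int M f ?ys \<in> universe M"
      using is_structure_fun[OF M f] ys by (auto simp: universe_def)
    ultimately show ?thesis
      using i_\<sigma> by simp
  qed
  moreover have "map ?i ` rel_int M r = rel_int M r" if r: "r \<in> rels M" for r
  proof -
    have "map ?i ` map \<sigma> ` rel_int M r = (\<lambda>xs. xs) ` rel_int M r"
      unfolding image_image
      by (intro image_cong refl map_i_\<sigma> subsetD[OF rel_int_subset_lists[OF M r]])
    then show ?thesis
      using AutD(4)[OF \<sigma> r] by simp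
  qed
  ultimately show ?thesis
    using restrict_inv_into_Bij[OF AutD(1)[OF \<sigma>]] by (auto simp: Aut_def)
qed

lemma Aut_inverseE:
  assumes "is_structure M" and "\<sigma> \<in> Aut M"
  obtains \<sigma>' where "\<sigma>' \<in> Aut M" "\<And>x. x \<in> universe M \<Longrightarrow> \<sigma>' (\<sigma> x) = x"
    "\<And>x. x \<in> universe M \<Longrightarrow> \<sigma> (\<sigma>' x) = x"
  using that[OF inverse_in_Aut[OF assms]] Aut_bij_betw[OF assms(2)] Aut_mem[OF assms(2)]
  by (simp add: bij_betw_inv_into_left bij_betw_inv_into_right)

lemma group_Aut_group:
  assumes M: "is_structure M"
  shows "group (Aut_group M)"
proof -
  interpret group "BijGroup (universe M)"
    by (rule group_BijGroup)
  have "subgroup (Aut M) (BijGroup (universe M))"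
  proof (rule subgroupI)
    show "Aut M \<subseteq> carrier (BijGroup (universe M))"
      using AutD(1) by (auto simp: BijGroup_def)
    show "Aut M \<noteq> {}"
      using id_in_Aut[OF M] by blast
    show "inv\<^bsub>BijGroup (universe M)\<^esub> \<sigma> \<in> Aut M" if "\<sigma> \<in> Aut M" for \<sigma>
    proof -
      have "inv\<^bsub>BijGroup (universe M)\<^esub> \<sigma> = (\<lambda>x\<in>universe M. inv_into (universe M) \<sigma> x)"
        by (rule inv_equality)
          (use AutD(1)[OF that] restrict_inv_into_Bij[OF AutD(1)[OF that]] in
            \<open>simp_all add: BijGroup_def Bij_compose_restrict_eq\<close>)
      then show ?thesis
        using inverse_in_Aut[OF M that] by simp
    qed
    show "\<sigma> \<otimes>\<^bsub>BijGroup (universe M)\<^esub> \<rho> \<in> Aut M" if "\<sigma> \<in> Aut M" "\<rho> \<in> Aut M" for \<sigma> \<rho>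
      using compose_in_Aut[OF M that] AutD(1)[OF that(1)] AutD(1)[OF that(2)]
      by (simp add: BijGroup_def)
  qed
  then show ?thesis
    unfolding Aut_group_def by (rule subgroup_imp_group)
qed

lemma Aut_group_simps [simp]:
  "carrier (Aut_group M) = Aut M"
  "\<one>\<^bsub>Aut_group M\<^esub> = (\<lambda>x\<in>universe M. x)"
  "\<sigma> \<in> Aut M \<Longrightarrow> \<rho> \<in> Aut M \<Longrightarrow> \<sigma> \<otimes>\<^bsub>Aut_group M\<^esub> \<rho> = compose (universe M) \<sigma> \<rho>"
  using AutD(1) by (auto simp: Aut_group_def BijGroup_def)

lemma
  assumes M: "is_structure M" and N: "is_structure N" and h: "Aut_morphism M N h"
  shows Aut_morphism_mem: "\<sigma> \<in> Aut M \<Longrightarrow> h \<sigma> \<in> Aut N"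
    and Aut_morphism_id: "h (\<lambda>x\<in>universe M. x) = (\<lambda>x\<in>universe N. x)"
    and Aut_morphism_compose: "\<sigma> \<in> Aut M \<Longrightarrow> \<rho> \<in> Aut M \<Longrightarrow>
      h (compose (universe M) \<sigma> \<rho>) = compose (universe N) (h \<sigma>) (h \<rho>)"
proof -
  interpret group_hom "Aut_group M" "Aut_group N" h
    using group_Aut_group[OF M] group_Aut_group[OF N] h
    by (simp add: group_hom_def group_hom_axioms_def Aut_morphism_def)
  show mem: "h \<sigma> \<in> Aut N" if "\<sigma> \<in> Aut M" for \<sigma>
    using hom_closed that by simp
  show "h (\<lambda>x\<in>universe M. x) = (\<lambda>x\<in>universe N. x)"
    using hom_one by simp
  show "h (compose (universe M) \<sigma> \<rho>) = compose (universe N) (h \<sigma>) (h \<rho>)"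
    if "\<sigma> \<in> Aut M" "\<rho> \<in> Aut M"
    using hom_mult[of \<sigma> \<rho>] that mem by simp
qed

section \<open>The topology of pointwise convergence in terms of finite sets\<close>

lemma topspace_Aut_topology: "topspace (Aut_topology M) = Aut M"
proof -
  have "Aut M \<subseteq> PiE (universe M) (\<lambda>_. universe M)"
    using AutD(1) by (auto simp: PiE_def dest: Bij_imp_extensional Bij_imp_funcset)
  then show ?thesis
    by (auto simp: Aut_topology_def)
qed

text \<open>A basic open set of the product constrains finitely many coordinates only; at the others
  it asks for membership in the universe, which every automorphism respects.\<close>

lemma openin_Aut_topologyD:
  assumes "openin (Aut_topology M) S" and "\<sigma> \<in> S"
  obtains F where "finite F" "F \<subseteq> universe M"
    "\<And>\<sigma>'. \<sigma>' \<in> Aut M \<Longrightarrow> (\<And>x. x \<in> F \<Longrightarrow> \<sigma>' x = \<sigma> x) \<Longrightarrow> \<sigma>' \<in> S"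
proof -
  let ?P = "product_topology (\<lambda>_. discrete_topology (universe M)) (universe M)"
  obtain T where T: "openin ?P T" "S = T \<inter> Aut M"
    using assms(1) by (auto simp: Aut_topology_def openin_subtopology)
  have "\<sigma> \<in> T"
    using T(2) assms(2) by blast
  then obtain W where W: "finite {i \<in> universe M. W i \<noteq> universe M}"
    "\<sigma> \<in> PiE (universe M) W" "PiE (universe M) W \<subseteq> T"
    using T(1) unfolding openin_product_topology_alt by (auto simp del: PiE_iff)
  have "\<sigma>' \<in> S" if \<sigma>': "\<sigma>' \<in> Aut M"
    and eq: "\<And>x. x \<in> {i \<in> universe M. W i \<noteq> universe M} \<Longrightarrow> \<sigma>' x = \<sigma> x" for \<sigma>'
  proof -
    have "\<sigma>' x \<in> W x" if "x \<in> universe M" for x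
    proof (cases "W x = universe M")
      case True
      then show ?thesis
        using Aut_mem[OF \<sigma>' that] by simp
    next
      case False
      then show ?thesis
        using eq[of x] that W(2) by (auto simp: PiE_iff)
    qed
    then have "\<sigma>' \<in> PiE (universe M) W"
      using AutD(1)[OF \<sigma>'] Bij_imp_extensional by (auto simp: PiE_iff)
    then show ?thesis
      using W(3) T(2) \<sigma>' by blast
  qed
  with that[OF W(1)] show thesis
    by blast
qed

lemma openin_Aut_topology_eval: "openin (Aut_topology M) {\<sigma> \<in> Aut M. \<sigma> x = c}"
proof (cases "x \<in> universe M")
  case x: True
  let ?P = "product_topology (\<lambda>_. discrete_topology (universe M)) (universe M)"
  have "continuous_map ?P (discrete_topology (universe M)) (\<lambda>\<sigma>. \<sigma> x)"
    using x by (rule continuous_map_product_projection)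
  then have "openin ?P {\<sigma> \<in> topspace ?P. \<sigma> x \<in> {c} \<inter> universe M}"
    by (rule openin_continuous_map_preimage) simp
  moreover have "{\<sigma> \<in> topspace ?P. \<sigma> x \<in> {c} \<inter> universe M} \<inter> Aut M = {\<sigma> \<in> Aut M. \<sigma> x = c}"
    using topspace_Aut_topology[of M] Aut_mem[OF _ x] by (auto simp: Aut_topology_def)
  ultimately show ?thesis
    unfolding Aut_topology_def openin_subtopology by blast
next
  case False
  then have "\<sigma> x = undefined" if "\<sigma> \<in> Aut M" for \<sigma>
    using AutD(1)[OF that] Bij_imp_extensional extensional_arb by metis
  then have "{\<sigma> \<in> Aut M. \<sigma> x = c} = (if c = undefined then Aut M else {})"
    by auto
  then show ?thesis
    using openin_topspace[of "Aut_topology M"] by (simp add: topspace_Aut_topology)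
qed

text \<open>Evaluation of \<open>h\<close> at a single point is locally constant, and finiteness of
  \<open>Z\<close> allows the neighbourhoods for its points to be intersected.\<close>

lemma continuous_map_Aut_topologyD:
  assumes h: "continuous_map (Aut_topology M) (Aut_topology N) h" and \<sigma>: "\<sigma> \<in> Aut M"
    and Z: "finite Z"
  obtains F where "finite F" "F \<subseteq> universe M"
    "\<And>\<sigma>' n. \<sigma>' \<in> Aut M \<Longrightarrow> (\<forall>x\<in>F. \<sigma>' x = \<sigma> x) \<Longrightarrow> n \<in> Z \<Longrightarrow> h \<sigma>' n = h \<sigma> n"
proof -
  have "\<exists>F. finite F \<and> F \<subseteq> universe M \<and>
      (\<forall>\<sigma>'\<in>Aut M. (\<forall>x\<in>F. \<sigma>' x = \<sigma> x) \<longrightarrow> h \<sigma>' n = h \<sigma> n)" for n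
  proof -
    let ?S = "{\<sigma>' \<in> topspace (Aut_topology M). h \<sigma>' \<in> {\<tau> \<in> Aut N. \<tau> n = h \<sigma> n}}"
    have "openin (Aut_topology M) ?S"
      using h openin_Aut_topology_eval by (rule openin_continuous_map_preimage)
    moreover have "\<sigma> \<in> ?S"
      using \<sigma> continuous_map_image_subset_topspace[OF h]
      by (auto simp: topspace_Aut_topology image_subset_iff)
    ultimately obtain F where F: "finite F" "F \<subseteq> universe M"
      "\<And>\<sigma>'. \<sigma>' \<in> Aut M \<Longrightarrow> (\<And>x. x \<in> F \<Longrightarrow> \<sigma>' x = \<sigma> x) \<Longrightarrow> \<sigma>' \<in> ?S"
      by (rule openin_Aut_topologyD) blast
    have "h \<sigma>' n = h \<sigma> n" if "\<sigma>' \<in> Aut M" "\<forall>x\<in>F. \<sigma>' x = \<sigma> x" for \<sigma>'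
      using F(3)[OF that(1)] that(2) by simp
    with F(1,2) show ?thesis
      by blast
  qed
  then obtain F where F: "\<And>n. finite (F n)" "\<And>n. F n \<subseteq> universe M"
    "\<And>n \<sigma>'. \<sigma>' \<in> Aut M \<Longrightarrow> (\<forall>x\<in>F n. \<sigma>' x = \<sigma> x) \<Longrightarrow> h \<sigma>' n = h \<sigma> n"
    by metis
  show thesis
  proof (rule that[of "\<Union>n\<in>Z. F n"])
    show "finite (\<Union>n\<in>Z. F n)" "(\<Union>n\<in>Z. F n) \<subseteq> universe M"
      using F(1,2) Z by auto
    fix \<sigma>' n
    assume "\<sigma>' \<in> Aut M" "\<forall>x\<in>(\<Union>n\<in>Z. F n). \<sigma>' x = \<sigma> x" "n \<in> Z"
    then show "h \<sigma>' n = h \<sigma> n"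
      by (intro F(3)) auto
  qed
qed

section \<open>Finite invariant sets\<close>

text \<open>The two claims need each other: \<sigma> commutes with a function symbol only on
  arguments of the right sorts.\<close>

lemma tm_val_automorphism:
  assumes M: "is_structure M" and \<sigma>: "\<sigma> \<in> Aut M"
  shows "has_sort M t s \<Longrightarrow>
    (\<And>w. w \<in> tm_fv t \<Longrightarrow> e w \<in> sort_set M (fst w) \<and> e' w = \<sigma> (e w)) \<Longrightarrow>
    tm_val M e t \<in> sort_set M s \<and> tm_val M e' t = \<sigma> (tm_val M e t)"
proof (induction rule: has_sort.induct)
  case (2 f ts)
  have *: "list_all2 (\<lambda>t s. tm_val M e t \<in> sort_set M s \<and> tm_val M e' t = \<sigma> (tm_val M e t))
      ts (fun_dom M f)"
    unfolding list_all2_conv_all_nth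
  proof (intro conjI allI impI)
    show "length ts = length (fun_dom M f)"
      using 2(2) by (rule list_all2_lengthD)
    fix k assume k: "k < length ts"
    have fv: "tm_fv (ts ! k) \<subseteq> tm_fv (App f ts)"
      using nth_mem[OF k] by auto
    then have "tm_val M e (ts ! k) \<in> sort_set M (fun_dom M f ! k) \<and>
        tm_val M e' (ts ! k) = \<sigma> (tm_val M e (ts ! k))"
      using list_all2_nthD[OF 2(2) k] 2(3) by blast
    then show "tm_val M e (ts ! k) \<in> sort_set M (fun_dom M f ! k)"
      "tm_val M e' (ts ! k) = \<sigma> (tm_val M e (ts ! k))"
      by blast+
  qed
  have args: "map (tm_val M e) ts \<in> sort_prod M (fun_dom M f)"
    using * by (auto simp: sort_prod_eq list_all2_conv_all_nth)
  have "map (tm_val M e') ts = map \<sigma> (map (tm_val M e) ts)"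
    using * by (auto simp: list_all2_conv_all_nth in_set_conv_nth)
  then show ?case
    using AutD(3)[OF \<sigma> 2(1) args] is_structure_fun(3)[OF M 2(1) args]
    by (simp del: map_map)
qed auto


text \<open>Only free variables are constrained, because \<open>fo_definable_set\<close> quantifies
  over all valuations, including those with values outside the sorts. For the quantifier, witnesses
  transfer both ways since \<sigma> maps each sort onto itself.\<close>

lemma sat_automorphism:
  assumes M: "is_structure M" and \<sigma>: "\<sigma> \<in> Aut M"
  shows "well_sorted M \<phi> \<Longrightarrow>
    (\<And>w. w \<in> fm_fv \<phi> \<Longrightarrow> e w \<in> sort_set M (fst w) \<and> e' w = \<sigma> (e w)) \<Longrightarrow>
    sat M e' \<phi> \<longleftrightarrow> sat M e \<phi>"
proof (induction \<phi> arbitrary: e e')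
  case (Eq t u)
  obtain s where s: "has_sort M t s" "has_sort M u s"
    using Eq(1) by auto
  have t: "tm_val M e t \<in> sort_set M s \<and> tm_val M e' t = \<sigma> (tm_val M e t)"
    by (rule tm_val_automorphism[OF M \<sigma> s(1)]) (use Eq(2) in auto)
  have u: "tm_val M e u \<in> sort_set M s \<and> tm_val M e' u = \<sigma> (tm_val M e u)"
    by (rule tm_val_automorphism[OF M \<sigma> s(2)]) (use Eq(2) in auto)
  have "s \<in> sorts M"
    using s(1) by cases (use is_structure_fun(2)[OF M] in auto)
  then show ?case
    using t u Aut_inj[OF \<sigma>] by (auto simp: universe_def)
next
  case (Rel r ts)
  have r: "r \<in> rels M" and ts: "list_all2 (has_sort M) ts (rel_dom M r)"
    using Rel(1) by auto
  have *: "tm_val M e (ts ! k) \<in> sort_set M (rel_dom M r ! k) \<and>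
      tm_val M e' (ts ! k) = \<sigma> (tm_val M e (ts ! k))" if k: "k < length ts" for k
  proof (rule tm_val_automorphism[OF M \<sigma> list_all2_nthD[OF ts k]])
    fix w assume "w \<in> tm_fv (ts ! k)"
    then show "e w \<in> sort_set M (fst w) \<and> e' w = \<sigma> (e w)"
      using Rel(2)[of w] nth_mem[OF k] by auto
  qed
  have "map (tm_val M e) ts \<in> sort_prod M (rel_dom M r)"
    using * list_all2_lengthD[OF ts] by (simp add: sort_prod_eq list_all2_conv_all_nth)
  then have args: "map (tm_val M e) ts \<in> lists (universe M)"
    using sort_prod_subset_lists is_structure_rel(1)[OF M r] by blast
  have eq: "map (tm_val M e') ts = map \<sigma> (map (tm_val M e) ts)"
    using * by (simp add: list_eq_iff_nth_eq)
  have inj: "inj_on (map \<sigma>) (lists (universe M))"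
    using Aut_bij_betw[OF \<sigma>] bij_betw_imp_inj_on inj_on_map_lists by blast
  have "map \<sigma> (map (tm_val M e) ts) \<in> map \<sigma> ` rel_int M r \<longleftrightarrow> map (tm_val M e) ts \<in> rel_int M r"
    by (rule inj_on_image_mem_iff[OF inj args rel_int_subset_lists[OF M r]])
  then show ?case
    unfolding AutD(4)[OF \<sigma> r] by (simp add: eq del: map_map)
next
  case (Conj \<phi> \<psi>)
  have "sat M e' \<phi> \<longleftrightarrow> sat M e \<phi>" "sat M e' \<psi> \<longleftrightarrow> sat M e \<psi>"
    using Conj by simp_all
  then show ?case
    by simp
next
  case (Ex v \<phi>)
  have v: "fst v \<in> sorts M" and ws: "well_sorted M \<phi>"
    using Ex(2) by auto
  have IH: "sat M (e'(v := \<sigma> x)) \<phi> \<longleftrightarrow> sat M (e(v := x)) \<phi>" if "x \<in> sort_set M (fst v)" for x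
    by (rule Ex(1)[OF ws]) (use Ex(3) that in auto)
  have "sat M e' (Ex v \<phi>) \<longleftrightarrow> (\<exists>x\<in>\<sigma> ` sort_set M (fst v). sat M (e'(v := x)) \<phi>)"
    using AutD(2)[OF \<sigma> v] by simp
  then show ?case
    using IH by auto
qed auto

lemma fo_definable_set_invariant:
  assumes M: "is_structure M" and \<sigma>: "\<sigma> \<in> Aut M" and X: "fo_definable_set M X"
  shows "\<sigma> ` X \<subseteq> X"
proof
  fix y assume "y \<in> \<sigma> ` X"
  then obtain x where x: "x \<in> X" and y: "y = \<sigma> x"
    by blast
  obtain \<phi> v where v: "fst v \<in> sorts M" "well_sorted M \<phi>" "fm_fv \<phi> \<subseteq> {v}"
    and X_eq: "X = {x \<in> sort_set M (fst v). \<forall>e. sat M (e(v := x)) \<phi>}"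
    using X by (auto simp: fo_definable_set_def)
  have x_sort: "x \<in> sort_set M (fst v)"
    using x X_eq by simp
  have "sat M (e(v := y)) \<phi>" for e
  proof -
    have "sat M (e(v := y)) \<phi> \<longleftrightarrow> sat M (e(v := x)) \<phi>"
      by (rule sat_automorphism[OF M \<sigma> v(2)]) (use v(3) x_sort y in auto)
    then show ?thesis
      using x X_eq by simp
  qed
  moreover have "y \<in> sort_set M (fst v)"
    using AutD(2)[OF \<sigma> v(1)] x_sort y by blast
  ultimately show "y \<in> X"
    by (simp add: X_eq)
qed

text \<open>Each point lies in a finite first-order definable set, and such sets are invariant. From
  here on, finitariness is used only in this form.\<close>

lemma finitary_finite_invariant:
  assumes M: "is_structure M" "finitary M" and F: "finite F" "F \<subseteq> universe M"
  obtains F' where "finite F'" "F \<subseteq> F'" "F' \<subseteq> universe M"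
    "\<And>\<sigma> x. \<sigma> \<in> Aut M \<Longrightarrow> x \<in> F' \<Longrightarrow> \<sigma> x \<in> F'"
proof -
  have "\<exists>X. finite X \<and> fo_definable_set M X \<and> m \<in> X" if "m \<in> universe M" for m
    using M(2) that by (auto simp: finitary_def acl_empty_def)
  then obtain X where X: "\<And>m. m \<in> universe M \<Longrightarrow> finite (X m)"
    "\<And>m. m \<in> universe M \<Longrightarrow> fo_definable_set M (X m)"
    "\<And>m. m \<in> universe M \<Longrightarrow> m \<in> X m"
    by metis
  have "X m \<subseteq> universe M" if "m \<in> universe M" for m
    using X(2)[OF that] by (auto simp: fo_definable_set_def universe_def)
  then show thesis
    using that[of "\<Union>m\<in>F. X m"] X F fo_definable_set_invariant[OF M(1)]
    by (smt (verit, best) UN_E UN_I UN_least finite_UN_I image_subset_iff subset_iff)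
qed

section \<open>Cofinal families of finite sets\<close>

text \<open>A set of size n + 1 is a set of size n with one point of \<open>P\<close> inserted, so
  by induction each size contributes at most |P| sets; countably many sizes do not exceed an
  infinite |P|.\<close>

lemma card_of_finite_subsets_ordLeq:
  includes cardinal_syntax
  assumes P: "infinite P"
  shows "|{Z. finite Z \<and> Z \<subseteq> P}| \<le>o |P|"
proof -
  define F where "F n = {Z. finite Z \<and> Z \<subseteq> P \<and> card Z = n}" for n
  have "|F n| \<le>o |P|" for n
  proof (induction n)
    case 0
    have "F 0 = {{}}"
      by (auto simp: F_def)
    then show ?case
      using P by (metis card_of_singl_ordLeq finite.emptyI)
  next
    case (Suc n)
    have "F (Suc n) \<subseteq> (\<Union>Z\<in>F n. (\<lambda>x. insert x Z) ` P)"
    proof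
      fix Y assume Y: "Y \<in> F (Suc n)"
      then obtain x Z where "Y = insert x Z" "x \<notin> Z" "card Z = n" "finite Z"
        by (auto simp: F_def card_Suc_eq_finite)
      then show "Y \<in> (\<Union>Z\<in>F n. (\<lambda>x. insert x Z) ` P)"
        using Y by (auto simp: F_def)
    qed
    moreover have "|\<Union>Z\<in>F n. (\<lambda>x. insert x Z) ` P| \<le>o |P|"
      by (rule card_of_UNION_ordLeq_infinite[OF P Suc]) (simp add: card_of_image)
    ultimately show ?case
      using card_of_mono1 ordLeq_transitive by blast
  qed
  then have "|\<Union>n. F n| \<le>o |P|"
    using P by (intro card_of_UNION_ordLeq_infinite) (auto simp: infinite_iff_card_of_nat)
  moreover have "(\<Union>n. F n) = {Z. finite Z \<and> Z \<subseteq> P}"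
    by (auto simp: F_def)
  ultimately show ?thesis
    by simp
qed

text \<open>In the application \<open>P\<close> consists of orbit representatives and
  \<open>B\<close> gives the orbits. An infinite \<open>P\<close> has a surjection onto its finite
  subsets, which assigns to each index a finite union of the sets \<open>B\<close>; for finite
  \<open>P\<close> the whole union is finite.\<close>

lemma cofinal_finite_sets:
  assumes P: "P \<noteq> {}" and B: "\<And>q. q \<in> P \<Longrightarrow> finite (B q)"
  obtains e where "\<And>q. q \<in> P \<Longrightarrow> finite (e q)" "\<And>q. q \<in> P \<Longrightarrow> e q \<subseteq> (\<Union>q\<in>P. B q)"
    "\<And>Z. finite Z \<Longrightarrow> Z \<subseteq> (\<Union>q\<in>P. B q) \<Longrightarrow> \<exists>q\<in>P. Z \<subseteq> e q"
proof (cases "finite P")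
  case True
  show thesis
    by (rule that[of "\<lambda>_. \<Union>q\<in>P. B q"]) (use True P B in auto)
next
  case False
  obtain f where f: "f ` P = {Z. finite Z \<and> Z \<subseteq> P}"
    using card_of_finite_subsets_ordLeq[OF False] card_of_ordLeq2[of "{Z. finite Z \<and> Z \<subseteq> P}" P]
    by auto
  show thesis
  proof (rule that[of "\<lambda>q. \<Union>q'\<in>f q. B q'"])
    fix q assume "q \<in> P"
    then have "finite (f q)" "f q \<subseteq> P"
      using f by blast+
    then show "finite (\<Union>q'\<in>f q. B q')" "(\<Union>q'\<in>f q. B q') \<subseteq> (\<Union>q\<in>P. B q)"
      using B by auto
  next
    fix Z assume "finite Z" "Z \<subseteq> (\<Union>q\<in>P. B q)"
    then obtain c where c: "\<And>z. z \<in> Z \<Longrightarrow> c z \<in> P" "\<And>z. z \<in> Z \<Longrightarrow> z \<in> B (c z)"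
      by (metis UN_E subset_iff)
    have "c ` Z \<in> f ` P"
      using f c(1) \<open>finite Z\<close> by auto
    then obtain q where "q \<in> P" "f q = c ` Z"
      by auto
    then show "\<exists>q\<in>P. Z \<subseteq> (\<Union>q'\<in>f q. B q')"
      using c(2) by force
  qed
qed

section \<open>Imaginaries\<close>

lemma act_Pair: "act \<sigma> (l, C) = (l, map \<sigma> ` C)"
  by (simp add: act_def)

lemma map_image_compose:
  "C \<subseteq> lists U \<Longrightarrow> map (compose U \<sigma> \<rho>) ` C = map \<sigma> ` map \<rho> ` C"
  unfolding image_image by (intro image_cong refl map_compose) blast

lemma map_image_identity:
  assumes "C \<subseteq> lists U" "\<And>x. x \<in> U \<Longrightarrow> f x = x"
  shows "map f ` C = C"
proof -
  have "map f ` C = (\<lambda>xs. xs) ` C"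
    by (intro image_cong refl map_idI) (use assms in blast)
  then show ?thesis
    by simp
qed

lemma Eq_univ_subset_lists: "(l, C) \<in> Eq_univ M A \<Longrightarrow> C \<subseteq> lists (universe M)"
  by (fastforce simp: Eq_univ_def definable_sort_def quotient_def equiv_def refl_on_def)

lemma act_compose:
  assumes "a \<in> Eq_univ M A"
  shows "act (compose (universe M) \<sigma> \<rho>) a = act \<sigma> (act \<rho> a)"
proof -
  obtain l C where a: "a = (l, C)"
    by fastforce
  then show ?thesis
    using map_image_compose[OF Eq_univ_subset_lists] assms by (simp add: act_Pair)
qed

lemma act_identity:
  assumes "a \<in> Eq_univ M A" "\<And>x. x \<in> universe M \<Longrightarrow> \<sigma> x = x"
  shows "act \<sigma> a = a"
proof -
  obtain l C where a: "a = (l, C)"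
    by fastforce
  then show ?thesis
    using map_image_identity[OF Eq_univ_subset_lists assms(2)] assms(1) by (simp add: act_Pair)
qed

lemma Aut_over_empty: "Aut_over M {} = Aut M"
  by (simp add: Aut_over_def)

lemma compose_in_Aut_over:
  assumes "is_structure M" "A \<subseteq> Eq_univ M {}" "\<sigma> \<in> Aut_over M A" "\<rho> \<in> Aut_over M A"
  shows "compose (universe M) \<sigma> \<rho> \<in> Aut_over M A"
proof -
  have "act (compose (universe M) \<sigma> \<rho>) a = a" if "a \<in> A" for a
  proof -
    have "a \<in> Eq_univ M {}"
      using that assms(2) by blast
    then show ?thesis
      using that assms(3,4) by (simp add: act_compose Aut_over_def)
  qed
  then show ?thesis
    using assms(3,4) compose_in_Aut[OF assms(1)] by (simp add: Aut_over_def)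
qed

lemma id_in_Aut_over:
  assumes "is_structure M" "A \<subseteq> Eq_univ M {}"
  shows "(\<lambda>x\<in>universe M. x) \<in> Aut_over M A"
proof -
  have "act (\<lambda>x\<in>universe M. x) a = a" if "a \<in> A" for a
    by (rule act_identity[of a M "{}"]) (use that assms(2) in auto)
  then show ?thesis
    using id_in_Aut[OF assms(1)] by (simp add: Aut_over_def)
qed

lemma Aut_over_inverseE:
  assumes "is_structure M" "A \<subseteq> Eq_univ M {}" "\<sigma> \<in> Aut_over M A"
  obtains \<sigma>' where "\<sigma>' \<in> Aut_over M A" "\<And>x. x \<in> universe M \<Longrightarrow> \<sigma>' (\<sigma> x) = x"
    "\<And>x. x \<in> universe M \<Longrightarrow> \<sigma> (\<sigma>' x) = x"
proof -
  have \<sigma>: "\<sigma> \<in> Aut M" "\<And>a. a \<in> A \<Longrightarrow> act \<sigma> a = a"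
    using assms(3) by (auto simp: Aut_over_def)
  obtain \<sigma>' where \<sigma>': "\<sigma>' \<in> Aut M" "\<And>x. x \<in> universe M \<Longrightarrow> \<sigma>' (\<sigma> x) = x"
    "\<And>x. x \<in> universe M \<Longrightarrow> \<sigma> (\<sigma>' x) = x"
    using Aut_inverseE[OF assms(1) \<sigma>(1)] by blast
  have "act \<sigma>' a = a" if "a \<in> A" for a
  proof -
    have a: "a \<in> Eq_univ M {}"
      using that assms(2) by blast
    have "act \<sigma>' a = act \<sigma>' (act \<sigma> a)"
      using \<sigma>(2)[OF that] by simp
    also have "\<dots> = act (compose (universe M) \<sigma>' \<sigma>) a"
      by (rule act_compose[OF a, symmetric])
    also have "\<dots> = a"
      by (rule act_identity[OF a]) (simp add: compose_eq \<sigma>'(2))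
    finally show ?thesis .
  qed
  then have "\<sigma>' \<in> Aut_over M A"
    using \<sigma>'(1) by (simp add: Aut_over_def)
  then show thesis
    using that \<sigma>'(2,3) by blast
qed

text \<open>A block of the group \<open>Aut_over M A\<close> is a class of some D/E:
  \<open>D\<close> is the union of its translates and \<open>E\<close> the partition of
  \<open>D\<close> into translates.\<close>

lemma Eq_univI:
  assumes M: "is_structure M" "A \<subseteq> Eq_univ M {}"
    and C: "C \<noteq> {}" "C \<subseteq> {xs. set xs \<subseteq> universe M \<and> length xs = k}"
    and block: "\<And>\<sigma>. \<sigma> \<in> Aut_over M A \<Longrightarrow> map \<sigma> ` C \<inter> C \<noteq> {} \<Longrightarrow> map \<sigma> ` C = C"
  shows "(l, C) \<in> Eq_univ M A"
proof -
  let ?G = "Aut_over M A"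
  let ?T = "\<lambda>\<sigma>. map \<sigma> ` C"
  define D where "D = (\<Union>\<sigma>\<in>?G. ?T \<sigma>)"
  define E where "E = (\<Union>\<sigma>\<in>?G. ?T \<sigma> \<times> ?T \<sigma>)"
  have C_lists: "C \<subseteq> lists (universe M)"
    using C(2) by auto
  have G_mem: "\<sigma> x \<in> universe M" if "\<sigma> \<in> ?G" "x \<in> universe M" for \<sigma> x
    using that Aut_mem by (auto simp: Aut_over_def)
  have T_lists: "?T \<sigma> \<subseteq> lists (universe M)" if "\<sigma> \<in> ?G" for \<sigma>
    by (auto dest!: subsetD[OF C_lists] simp: G_mem[OF that])
  have T_comp: "map \<sigma> ` ?T \<rho> = ?T (compose (universe M) \<sigma> \<rho>)" for \<sigma> \<rho>
    by (rule map_image_compose[OF C_lists, symmetric])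
  have comp: "compose (universe M) \<sigma> \<rho> \<in> ?G" if "\<sigma> \<in> ?G" "\<rho> \<in> ?G" for \<sigma> \<rho>
    using compose_in_Aut_over[OF M that] .
  have C_T: "C = ?T (\<lambda>x\<in>universe M. x)"
    by (rule map_image_identity[OF C_lists, symmetric]) simp
  \<comment> \<open>Applying the inverse of \<sigma> turns the intersection into one of
    \<open>C\<close> with a translate of \<open>C\<close>, where \<open>block\<close>
    applies.\<close>
  have T_disj: "?T \<sigma> = ?T \<rho>" if \<sigma>: "\<sigma> \<in> ?G" and \<rho>: "\<rho> \<in> ?G" and "?T \<sigma> \<inter> ?T \<rho> \<noteq> {}" for \<sigma> \<rho>
  proof -
    obtain \<sigma>' where \<sigma>': "\<sigma>' \<in> ?G" "\<And>x. x \<in> universe M \<Longrightarrow> \<sigma>' (\<sigma> x) = x"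
      "\<And>x. x \<in> universe M \<Longrightarrow> \<sigma> (\<sigma>' x) = x"
      by (rule Aut_over_inverseE[OF M \<sigma>]) (rule that)
    have *: "map \<sigma>' ` ?T \<sigma> = C"
      unfolding T_comp by (rule map_image_identity[OF C_lists]) (simp add: compose_eq \<sigma>'(2))
    have "map \<sigma>' ` (?T \<sigma> \<inter> ?T \<rho>) \<subseteq> C \<inter> map \<sigma>' ` ?T \<rho>"
      using * by blast
    then have "?T (compose (universe M) \<sigma>' \<rho>) \<inter> C \<noteq> {}"
      using that(3) unfolding T_comp by blast
    then have "map \<sigma>' ` ?T \<rho> = C"
      using block[OF comp[OF \<sigma>'(1) \<rho>]] unfolding T_comp by blast
    then have "?T \<sigma> = map \<sigma> ` map \<sigma>' ` ?T \<rho>"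
      by simp
    also have "\<dots> = map (compose (universe M) \<sigma> \<sigma>') ` ?T \<rho>"
      by (rule map_image_compose[OF T_lists[OF \<rho>], symmetric])
    also have "\<dots> = ?T \<rho>"
      by (rule map_image_identity[OF T_lists[OF \<rho>]]) (simp add: compose_eq \<sigma>'(3))
    finally show ?thesis .
  qed
  have D_lists: "D \<subseteq> lists (universe M)"
    using T_lists by (auto simp: D_def)
  have E_lists: "E \<subseteq> lists (universe M) \<times> lists (universe M)"
    using T_lists unfolding E_def by blast
  have D_sub: "map \<sigma> ` D \<subseteq> D" if "\<sigma> \<in> ?G" for \<sigma>
    unfolding D_def image_UN T_comp using comp[OF that] by blast
  have E_sub: "map_prod (map \<sigma>) (map \<sigma>) ` E \<subseteq> E" if \<sigma>: "\<sigma> \<in> ?G" for \<sigma>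
  proof
    fix p assume "p \<in> map_prod (map \<sigma>) (map \<sigma>) ` E"
    then obtain \<rho> xs ys where \<rho>: "\<rho> \<in> ?G" and "xs \<in> ?T \<rho>" "ys \<in> ?T \<rho>"
      and p: "p = (map \<sigma> xs, map \<sigma> ys)"
      unfolding E_def by force
    then have "p \<in> map \<sigma> ` ?T \<rho> \<times> map \<sigma> ` ?T \<rho>"
      by blast
    then show "p \<in> E"
      unfolding E_def T_comp by (rule UN_I[OF comp[OF \<sigma> \<rho>]])
  qed
  \<comment> \<open>The inclusion, available for every group element, yields equality when it is
    used for the inverse of \<sigma>.\<close>
  have "map \<sigma> ` D = D" if \<sigma>: "\<sigma> \<in> ?G" for \<sigma>
  proof (rule antisym[OF D_sub[OF \<sigma>]])
    obtain \<sigma>' where \<sigma>': "\<sigma>' \<in> ?G" "\<And>x. x \<in> universe M \<Longrightarrow> \<sigma>' (\<sigma> x) = x"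
      "\<And>x. x \<in> universe M \<Longrightarrow> \<sigma> (\<sigma>' x) = x"
      by (rule Aut_over_inverseE[OF M \<sigma>]) (rule that)
    have "D = map (compose (universe M) \<sigma> \<sigma>') ` D"
      by (rule map_image_identity[OF D_lists, symmetric]) (simp add: compose_eq \<sigma>'(3))
    also have "\<dots> = map \<sigma> ` map \<sigma>' ` D"
      by (rule map_image_compose[OF D_lists])
    also have "\<dots> \<subseteq> map \<sigma> ` D"
      by (rule image_mono[OF D_sub[OF \<sigma>'(1)]])
    finally show "D \<subseteq> map \<sigma> ` D" .
  qed
  moreover have "map_prod (map \<sigma>) (map \<sigma>) ` E = E" if \<sigma>: "\<sigma> \<in> ?G" for \<sigma>
  proof (rule antisym[OF E_sub[OF \<sigma>]])
    obtain \<sigma>' where \<sigma>': "\<sigma>' \<in> ?G" "\<And>x. x \<in> universe M \<Longrightarrow> \<sigma>' (\<sigma> x) = x"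
      "\<And>x. x \<in> universe M \<Longrightarrow> \<sigma> (\<sigma>' x) = x"
      by (rule Aut_over_inverseE[OF M \<sigma>]) (rule that)
    have inv: "map \<sigma> (map \<sigma>' xs) = xs" if "xs \<in> lists (universe M)" for xs
      unfolding map_map o_def by (intro map_idI \<sigma>'(3)) (use that in blast)
    show "E \<subseteq> map_prod (map \<sigma>) (map \<sigma>) ` E"
    proof
      fix p assume p: "p \<in> E"
      obtain xs ys where xy: "p = (xs, ys)"
        by (cases p)
      have "p = map_prod (map \<sigma>) (map \<sigma>) (map_prod (map \<sigma>') (map \<sigma>') p)"
        using subsetD[OF E_lists p] unfolding xy by (simp add: inv del: map_map)
      then show "p \<in> map_prod (map \<sigma>) (map \<sigma>) ` E"
        by (rule image_eqI) (rule subsetD[OF E_sub[OF \<sigma>'(1)] imageI[OF p]])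
    qed
  qed
  moreover have "equiv D E"
  proof (rule equivI)
    show "E \<subseteq> D \<times> D"
      by (auto simp: D_def E_def)
    show "refl_on D E"
      by (rule refl_onI) (auto simp: D_def E_def)
    show "sym E"
      by (rule symI) (auto simp: E_def)
    show "trans E"
    proof (rule transI)
      fix x y z assume "(x, y) \<in> E" "(y, z) \<in> E"
      then obtain \<sigma> \<rho> where "\<sigma> \<in> ?G" "\<rho> \<in> ?G" "x \<in> ?T \<sigma>" "y \<in> ?T \<sigma>" "y \<in> ?T \<rho>" "z \<in> ?T \<rho>"
        unfolding E_def by blast
      moreover from this have "?T \<sigma> = ?T \<rho>"
        by (intro T_disj) blast+
      ultimately show "(x, z) \<in> E"
        unfolding E_def by blast
    qed
  qed
  moreover have "D \<subseteq> {xs. set xs \<subseteq> universe M \<and> length xs = k}"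
  proof
    fix xs assume "xs \<in> D"
    then obtain \<sigma> ys where \<sigma>: "\<sigma> \<in> ?G" and "ys \<in> C" "xs = map \<sigma> ys"
      unfolding D_def by blast
    moreover from this have "set ys \<subseteq> universe M" "length ys = k"
      using C(2) by blast+
    ultimately show "xs \<in> {xs. set xs \<subseteq> universe M \<and> length xs = k}"
      by (auto simp: G_mem[OF \<sigma>] subset_iff)
  qed
  ultimately have "definable_sort M A D E"
    by (auto simp: definable_sort_def definable_def definable_eqrel_def)
  moreover have "C \<in> D // E"
  proof -
    obtain x where x: "x \<in> C"
      using C(1) by blast
    have "C \<times> C \<subseteq> E"
      using id_in_Aut_over[OF M] C_T unfolding E_def by blast
    moreover have "y \<in> C" if "(x, y) \<in> E" for y
    proof -
      obtain \<sigma> where "\<sigma> \<in> ?G" "x \<in> ?T \<sigma>" "y \<in> ?T \<sigma>"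
        using \<open>(x, y) \<in> E\<close> unfolding E_def by blast
      then show ?thesis
        using block x by blast
    qed
    ultimately have "C = E `` {x}"
      using x by blast
    moreover have "x \<in> D"
      using x id_in_Aut_over[OF M] C_T unfolding D_def by blast
    ultimately show ?thesis
      by (simp add: quotientI)
  qed
  ultimately show ?thesis
    by (auto simp: Eq_univ_def)
qed

text \<open>Let y be the preimage of x. It cannot strictly precede x, since it would then be fixed
  by the induction hypothesis. So x is below y, and by monotonicity \<open>f x\<close> is below x.
  If \<open>f x\<close> were strictly below, it would be fixed as well, against injectivity.\<close>

lemma monotone_on_well_order_identity:
  assumes r: "well_order_on UNIV r" and f: "inj_on f F" "f ` F = F"
    and mono: "\<And>x y. x \<in> F \<Longrightarrow> y \<in> F \<Longrightarrow> (x, y) \<in> r \<Longrightarrow> (f x, f y) \<in> r"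
    and x: "x \<in> F"
  shows "f x = x"
proof -
  have wf: "wf (r - Id)" and total: "total r"
    using r by (auto simp: well_order_on_def linear_order_on_def)
  show ?thesis
    using x
  proof (induction x rule: wf_induct_rule[OF wf])
    case (1 x)
    have "x \<in> f ` F"
      using f(2) 1(2) by simp
    then obtain y where y: "y \<in> F" "f y = x"
      by blast
    have "(x, y) \<in> r \<or> x = y"
    proof (rule ccontr)
      assume neg: "\<not> ((x, y) \<in> r \<or> x = y)"
      then have "(y, x) \<in> r - Id"
        using total by (auto simp: total_on_def)
      then show False
        using 1(1) y neg by simp
    qed
    then have "(f x, x) \<in> r \<or> f x = x"
      using mono[OF 1(2) y(1)] y(2) by auto
    moreover have "f x \<in> F"
      using imageI[OF 1(2), of f] f(2) by simp
    ultimately show ?case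
      using 1(1)[of "f x"] 1(2) inj_onD[OF f(1)] by blast
  qed
qed

section \<open>Split morphisms of automorphism groups\<close>

locale split_morphism =
  fixes N :: "('t, 'g, 'q, 'b) mstruct" and M :: "('s, 'f, 'r, 'a) mstruct"
    and h :: "('a \<Rightarrow> 'a) \<Rightarrow> ('b \<Rightarrow> 'b)" and g :: "('b \<Rightarrow> 'b) \<Rightarrow> ('a \<Rightarrow> 'a)"
  assumes N: "is_structure N" "finitary N"
    and M: "is_structure M" "finitary M"
    and h: "Aut_morphism M N h"
    and g: "Aut_morphism N M g"
    and hg: "\<tau> \<in> Aut N \<Longrightarrow> h (g \<tau>) = \<tau>"
begin

abbreviation "U \<equiv> universe M"
abbreviation "V \<equiv> universe N"

lemma g_mem: "\<tau> \<in> Aut N \<Longrightarrow> g \<tau> \<in> Aut M"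
  by (rule Aut_morphism_mem[OF N(1) M(1) g])

lemma h_mem: "\<sigma> \<in> Aut M \<Longrightarrow> h \<sigma> \<in> Aut N"
  by (rule Aut_morphism_mem[OF M(1) N(1) h])

lemma g_closed: "\<tau> \<in> Aut N \<Longrightarrow> x \<in> U \<Longrightarrow> g \<tau> x \<in> U"
  by (rule Aut_mem[OF g_mem])

lemma g_compose:
  "\<tau> \<in> Aut N \<Longrightarrow> \<tau>' \<in> Aut N \<Longrightarrow> g (compose V \<tau> \<tau>') = compose U (g \<tau>) (g \<tau>')"
  by (rule Aut_morphism_compose[OF N(1) M(1) g])

text \<open>Stated for any \<tau> fixing \<open>V\<close> pointwise, so that it applies to products
  of \<tau> with its inverse without rewriting them to the extensional identity.\<close>

lemma g_identity:
  assumes "\<tau> \<in> Aut N" "\<And>n. n \<in> V \<Longrightarrow> \<tau> n = n" "x \<in> U"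
  shows "g \<tau> x = x"
proof -
  have "\<tau> = (\<lambda>n\<in>V. n)"
    by (rule Aut_eqI[OF assms(1) id_in_Aut[OF N(1)]]) (simp add: assms(2))
  then show ?thesis
    using Aut_morphism_id[OF N(1) M(1) g] assms(3) by simp
qed

lemma Aut_N_inverseE:
  assumes \<tau>: "\<tau> \<in> Aut N"
  obtains \<tau>' where "\<tau>' \<in> Aut N"
    "\<And>n. n \<in> V \<Longrightarrow> \<tau>' (\<tau> n) = n" "\<And>n. n \<in> V \<Longrightarrow> \<tau> (\<tau>' n) = n"
    "\<And>x. x \<in> U \<Longrightarrow> g \<tau>' (g \<tau> x) = x" "\<And>x. x \<in> U \<Longrightarrow> g \<tau> (g \<tau>' x) = x"
proof -
  obtain \<tau>' where \<tau>': "\<tau>' \<in> Aut N" "\<And>n. n \<in> V \<Longrightarrow> \<tau>' (\<tau> n) = n"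
    "\<And>n. n \<in> V \<Longrightarrow> \<tau> (\<tau>' n) = n"
    by (rule Aut_inverseE[OF N(1) \<tau>]) (rule that)
  have left: "g \<tau>' (g \<tau> x) = x" if "x \<in> U" for x
    using g_identity[OF compose_in_Aut[OF N(1) \<tau>'(1) \<tau>] _ that]
    by (simp add: g_compose \<tau> \<tau>' compose_eq that)
  have right: "g \<tau> (g \<tau>' x) = x" if "x \<in> U" for x
    using g_identity[OF compose_in_Aut[OF N(1) \<tau> \<tau>'(1)] _ that]
    by (simp add: g_compose \<tau> \<tau>' compose_eq that)
  show thesis
    by (rule that[OF \<tau>' left right])
qed

text \<open>
  The image of a section is closed: it is the fixed-point set of the continuous retraction
  \<open>g \<circ> h\<close>.
\<close>

lemma range_section_closed:
  assumes \<sigma>: "\<sigma> \<in> Aut M"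
    and approx: "\<And>F. finite F \<Longrightarrow> F \<subseteq> U \<Longrightarrow> \<exists>\<tau>\<in>Aut N. \<forall>x\<in>F. g \<tau> x = \<sigma> x"
  shows "\<sigma> \<in> g ` Aut N"
proof -
  have cont: "continuous_map (Aut_topology M) (Aut_topology M) (g \<circ> h)"
    using h g continuous_map_compose by (auto simp: Aut_morphism_def)
  have "g (h \<sigma>) m = \<sigma> m" if m: "m \<in> U" for m
  proof -
    obtain F where F: "finite F" "F \<subseteq> U"
      "\<And>\<sigma>' n. \<sigma>' \<in> Aut M \<Longrightarrow> (\<forall>x\<in>F. \<sigma>' x = \<sigma> x) \<Longrightarrow> n \<in> {m} \<Longrightarrow>
        (g \<circ> h) \<sigma>' n = (g \<circ> h) \<sigma> n"
      by (rule continuous_map_Aut_topologyD[OF cont \<sigma>, of "{m}"]) (simp, rule that)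
    \<comment> \<open>Agreement on \<open>F\<close> makes the retraction take the same value at
      \<open>g \<tau>\<close> and at \<sigma> in the point \<open>m\<close>; agreement at
      \<open>m\<close> itself then identifies this value as \<open>\<sigma> m\<close>.\<close>
    obtain \<tau> where \<tau>: "\<tau> \<in> Aut N" "\<forall>x\<in>insert m F. g \<tau> x = \<sigma> x"
      using approx[of "insert m F"] F(1,2) m by auto
    have "(g \<circ> h) (g \<tau>) m = (g \<circ> h) \<sigma> m"
      by (rule F(3)) (use \<tau> g_mem in auto)
    then show ?thesis
      using \<tau> hg by simp
  qed
  then have "g (h \<sigma>) = \<sigma>"
    by (intro Aut_eqI[OF g_mem[OF h_mem[OF \<sigma>]] \<sigma>])
  then show ?thesis
    using h_mem[OF \<sigma>] by (metis imageI)
qed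

text \<open>The parameter set \<open>A\<close> of the theorem; \<open>bracket_code\<close> shows
  that it is the bracket of the interpretation.\<close>

definition fixed_imaginaries :: "('l, 'a) imag set" where
  "fixed_imaginaries = {a \<in> Eq_univ M {}. \<forall>\<tau>\<in>Aut N. act (g \<tau>) a = a}"

lemma fixed_imaginaries_subset: "fixed_imaginaries \<subseteq> Eq_univ M {}"
  by (auto simp: fixed_imaginaries_def)

lemma g_translate_invariant:
  assumes xs: "set xs \<subseteq> U" and \<tau>: "\<tau> \<in> Aut N"
  defines "C \<equiv> {map (g \<rho>) xs | \<rho>. \<rho> \<in> Aut N}"
  shows "map (g \<tau>) ` C = C"
proof
  have comp: "map (g \<tau>') (map (g \<rho>) xs) = map (g (compose V \<tau>' \<rho>)) xs"
    if "\<tau>' \<in> Aut N" "\<rho> \<in> Aut N" for \<tau>' \<rho>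
    unfolding g_compose[OF that] using xs by (intro map_compose[symmetric]) auto
  show "map (g \<tau>) ` C \<subseteq> C"
    using compose_in_Aut[OF N(1) \<tau>] comp[OF \<tau>] unfolding C_def by blast
  show "C \<subseteq> map (g \<tau>) ` C"
  proof
    fix zs assume "zs \<in> C"
    then obtain \<rho> where \<rho>: "\<rho> \<in> Aut N" "zs = map (g \<rho>) xs"
      unfolding C_def by blast
    obtain \<tau>' where \<tau>': "\<tau>' \<in> Aut N"
      "\<And>n. n \<in> V \<Longrightarrow> \<tau>' (\<tau> n) = n" "\<And>n. n \<in> V \<Longrightarrow> \<tau> (\<tau>' n) = n"
      "\<And>x. x \<in> U \<Longrightarrow> g \<tau>' (g \<tau> x) = x" "\<And>x. x \<in> U \<Longrightarrow> g \<tau> (g \<tau>' x) = x"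
      by (rule Aut_N_inverseE[OF \<tau>]) (rule that)
    have "map (g \<tau>) (map (g \<tau>') zs) = zs"
      unfolding map_map o_def by (intro map_idI \<tau>'(5)) (use \<rho> xs g_closed in auto)
    moreover have "map (g \<tau>') zs \<in> C"
      using compose_in_Aut[OF N(1) \<tau>'(1) \<rho>(1)] comp[OF \<tau>'(1) \<rho>(1)] \<rho>(2)
      unfolding C_def by blast
    ultimately show "zs \<in> map (g \<tau>) ` C"
      by (metis imageI)
  qed
qed

text \<open>A Galois correspondence for the closed subgroup. The orbit of an enumeration of a finite
  invariant set under the image of \<open>g\<close> is a fixed imaginary. An automorphism preserving
  this orbit agrees on the finite set with some \<open>g \<tau>\<close>.\<close>

lemma Aut_over_fixed_imaginaries:
  "Aut_over M (fixed_imaginaries :: ('l, 'a) imag set) = g ` Aut N"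
proof
  show "g ` Aut N \<subseteq> Aut_over M (fixed_imaginaries :: ('l, 'a) imag set)"
    using g_mem by (auto simp: Aut_over_def fixed_imaginaries_def)
  show "Aut_over M (fixed_imaginaries :: ('l, 'a) imag set) \<subseteq> g ` Aut N"
  proof
    fix \<sigma> assume "\<sigma> \<in> Aut_over M (fixed_imaginaries :: ('l, 'a) imag set)"
    then have \<sigma>: "\<sigma> \<in> Aut M"
      and fixed: "\<And>a. a \<in> (fixed_imaginaries :: ('l, 'a) imag set) \<Longrightarrow> act \<sigma> a = a"
      by (auto simp: Aut_over_def)
    show "\<sigma> \<in> g ` Aut N"
    proof (rule range_section_closed[OF \<sigma>])
      fix F assume "finite F" "F \<subseteq> U"
      then obtain F' where F': "finite F'" "F \<subseteq> F'" "F' \<subseteq> U"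
        "\<And>\<sigma> x. \<sigma> \<in> Aut M \<Longrightarrow> x \<in> F' \<Longrightarrow> \<sigma> x \<in> F'"
        by (rule finitary_finite_invariant[OF M]) (rule that)
      obtain xs where xs: "set xs = F'"
        using finite_list[OF F'(1)] by blast
      define C where "C = {map (g \<rho>) xs | \<rho>. \<rho> \<in> Aut N}"
      have inv: "map (g \<tau>) ` C = C" if "\<tau> \<in> Aut N" for \<tau>
        unfolding C_def using g_translate_invariant[OF _ that] xs F'(3) by blast
      have xs_C: "xs \<in> C"
        unfolding C_def
        using g_identity[OF id_in_Aut[OF N(1)]] id_in_Aut[OF N(1)] xs F'(3)
        by (auto intro!: exI[of _ "\<lambda>n\<in>V. n"] map_idI[symmetric])
      have C_lists: "C \<subseteq> lists F'"
        unfolding C_def using F'(4) g_mem xs by auto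
      \<comment> \<open>Any label would do. The class belongs to \<open>M\<close> without
        parameters, so the block property has to be checked against all of
        \<open>Aut M\<close>.\<close>
      have "(undefined, C) \<in> Eq_univ M {}"
      proof (rule Eq_univI[OF M(1)])
        show "C \<subseteq> {zs. set zs \<subseteq> U \<and> length zs = length xs}"
          using C_lists F'(3) by (auto simp: C_def)
        fix \<rho> assume "\<rho> \<in> Aut_over M {}" and "map \<rho> ` C \<inter> C \<noteq> {}"
        then obtain \<tau> \<tau>' where \<rho>: "\<rho> \<in> Aut M" and \<tau>: "\<tau> \<in> Aut N" and \<tau>': "\<tau>' \<in> Aut N"
          and eq: "map \<rho> (map (g \<tau>) xs) = map (g \<tau>') xs"
          unfolding C_def by (auto simp: Aut_over_empty)
        obtain \<tau>i where \<tau>i: "\<tau>i \<in> Aut N"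
          "\<And>n. n \<in> V \<Longrightarrow> \<tau>i (\<tau> n) = n" "\<And>n. n \<in> V \<Longrightarrow> \<tau> (\<tau>i n) = n"
          "\<And>x. x \<in> U \<Longrightarrow> g \<tau>i (g \<tau> x) = x" "\<And>x. x \<in> U \<Longrightarrow> g \<tau> (g \<tau>i x) = x"
          by (rule Aut_N_inverseE[OF \<tau>]) (rule that)
        \<comment> \<open>Since \<open>xs\<close> lists all of \<open>F'\<close>,
          \<open>g \<tau>i y\<close> is one of its entries. The equation of tuples thus determines
          \<rho> on all of \<open>F'\<close>, which contains every entry occurring in
          \<open>C\<close>.\<close>
        have "\<rho> y = g (compose V \<tau>' \<tau>i) y" if y: "y \<in> F'" for y
        proof -
          have yU: "y \<in> U"
            using y F'(3) by blast
          have "g \<tau>i y \<in> F'"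
            using F'(4) g_mem[OF \<tau>i(1)] y by blast
          then have "\<rho> (g \<tau> (g \<tau>i y)) = g \<tau>' (g \<tau>i y)"
            using eq xs by auto
          then show ?thesis
            using \<tau>i(5)[OF yU] yU by (simp add: g_compose[OF \<tau>' \<tau>i(1)] compose_eq)
        qed
        then have "map \<rho> ` C = map (g (compose V \<tau>' \<tau>i)) ` C"
          using C_lists by (intro image_cong refl map_cong) auto
        then show "map \<rho> ` C = C"
          using inv compose_in_Aut[OF N(1) \<tau>' \<tau>i(1)] by simp
      qed (use xs_C in auto)
      then have "(undefined, C) \<in> (fixed_imaginaries :: ('l, 'a) imag set)"
        using inv by (simp add: fixed_imaginaries_def act_Pair)
      then have "map \<sigma> ` C = C"
        using fixed act_Pair by (metis prod.inject)
      then have "map \<sigma> xs \<in> C"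
        using xs_C by blast
      then obtain \<tau> where "\<tau> \<in> Aut N" "map \<sigma> xs = map (g \<tau>) xs"
        by (auto simp: C_def)
      then show "\<exists>\<tau>\<in>Aut N. \<forall>x\<in>F. g \<tau> x = \<sigma> x"
        using xs F'(2) by (metis map_eq_conv subsetD)
    qed
  qed
qed

end

text \<open>
  \<open>rep\<close> picks one element of each orbit, \<open>base q\<close> is a finite tuple controlling the stabilizer of
  the representative \<open>q\<close>, and \<open>r\<close> is an auxiliary ordering that makes permutations of finite sets
  visible.
\<close>

locale coding = split_morphism N M h g
  for N :: "('t, 'g, 'q, 'b) mstruct" and M :: "('s, 'f, 'r, 'a) mstruct"
    and h :: "('a \<Rightarrow> 'a) \<Rightarrow> ('b \<Rightarrow> 'b)" and g :: "('b \<Rightarrow> 'b) \<Rightarrow> ('a \<Rightarrow> 'a)" +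
  fixes rep :: "'b \<Rightarrow> 'b" and base :: "'b \<Rightarrow> 'a list" and r :: "'a rel"
  assumes rep_mem: "n \<in> V \<Longrightarrow> rep n \<in> V"
    and rep_orbit: "n \<in> V \<Longrightarrow> \<exists>\<tau>\<in>Aut N. \<tau> (rep n) = n"
    and rep_invariant: "\<tau> \<in> Aut N \<Longrightarrow> n \<in> V \<Longrightarrow> rep (\<tau> n) = rep n"
    and base_subset: "q \<in> rep ` V \<Longrightarrow> set (base q) \<subseteq> U"
    and base_stabilizer: "q \<in> rep ` V \<Longrightarrow> \<sigma> \<in> Aut M \<Longrightarrow> (\<And>x. x \<in> set (base q) \<Longrightarrow> \<sigma> x = x) \<Longrightarrow>
      h \<sigma> q = q"
    and base_cofinal: "finite F \<Longrightarrow> F \<subseteq> U \<Longrightarrow>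
      \<exists>q\<in>rep ` V. \<forall>\<tau>\<in>Aut N. (\<forall>x\<in>set (base q). g \<tau> x = x) \<longrightarrow> (\<forall>x\<in>F. g \<tau> x = x)"
    and r: "well_order_on UNIV r"
begin

text \<open>The \<tau> with \<open>\<tau> (rep n) = n\<close> form a coset of the stabilizer of the
  representative, so the image of \<open>g\<close> permutes the classes as \<open>Aut N\<close>
  permutes the points. The ordering is imposed before translation, on the side of the
  representative.\<close>

definition code_set :: "'b \<Rightarrow> 'a list set" where
  "code_set n = {map (g \<tau>) (base (rep n) @ [x, y]) | \<tau> x y.
     \<tau> \<in> Aut N \<and> \<tau> (rep n) = n \<and> x \<in> U \<and> y \<in> U \<and> (x, y) \<in> r}"

text \<open>The label is needed because points of different orbits may have the same
  \<open>code_set\<close>, for instance when \<open>M\<close> has a single element. Automorphisms do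
  not move labels, and \<open>rep\<close> is constant on orbits.\<close>

definition code :: "'b \<Rightarrow> ('b, 'a) imag" where
  "code n = (rep n, code_set n)"

lemma code_setI:
  "\<tau> \<in> Aut N \<Longrightarrow> \<tau> (rep n) = n \<Longrightarrow> x \<in> U \<Longrightarrow> y \<in> U \<Longrightarrow> (x, y) \<in> r \<Longrightarrow>
    map (g \<tau>) (base (rep n) @ [x, y]) \<in> code_set n"
  unfolding code_set_def by blast

lemma rep_rep: "q \<in> rep ` V \<Longrightarrow> rep q = q"
  using rep_orbit rep_invariant rep_mem by (metis imageE)

lemma rep_subset: "rep ` V \<subseteq> V"
  using rep_mem by blast

lemma r_refl: "(x, x) \<in> r"
  using r by (simp add: well_order_on_def linear_order_on_def partial_order_on_def
      preorder_on_def refl_on_def)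

lemma code_set_lists:
  assumes "n \<in> V"
  shows "code_set n \<subseteq> {zs. set zs \<subseteq> U \<and> length zs = length (base (rep n)) + 2}"
proof
  fix zs assume "zs \<in> code_set n"
  then obtain \<tau> x y where "\<tau> \<in> Aut N" "x \<in> U" "y \<in> U"
    "zs = map (g \<tau>) (base (rep n) @ [x, y])"
    unfolding code_set_def by blast
  then show "zs \<in> {zs. set zs \<subseteq> U \<and> length zs = length (base (rep n)) + 2}"
    using base_subset[of "rep n"] assms g_closed by (auto simp: subset_iff)
qed

lemma code_set_subset_lists: "n \<in> V \<Longrightarrow> code_set n \<subseteq> lists U"
  using code_set_lists by auto

lemma code_set_nonempty:
  assumes "n \<in> V"
  shows "code_set n \<noteq> {}"
proof -
  obtain \<tau> where "\<tau> \<in> Aut N" "\<tau> (rep n) = n"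
    using rep_orbit[OF assms] by blast
  moreover obtain x where "x \<in> U"
    using M(1) by (auto simp: is_structure_def)
  ultimately have "map (g \<tau>) (base (rep n) @ [x, x]) \<in> code_set n"
    unfolding code_set_def using r_refl by blast
  then show ?thesis
    by blast
qed

lemma g_code_set_subset:
  assumes \<tau>: "\<tau> \<in> Aut N" and n: "n \<in> V"
  shows "map (g \<tau>) ` code_set n \<subseteq> code_set (\<tau> n)"
proof
  fix zs assume "zs \<in> map (g \<tau>) ` code_set n"
  then obtain \<rho> x y where \<rho>: "\<rho> \<in> Aut N" "\<rho> (rep n) = n" and xy: "x \<in> U" "y \<in> U" "(x, y) \<in> r"
    and zs: "zs = map (g \<tau>) (map (g \<rho>) (base (rep n) @ [x, y]))"
    unfolding code_set_def by blast
  have "base (rep n) @ [x, y] \<in> lists U"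
    using base_subset[of "rep n"] n xy by auto
  then have "zs = map (g (compose V \<tau> \<rho>)) (base (rep (\<tau> n)) @ [x, y])"
    unfolding g_compose[OF \<tau> \<rho>(1)] zs rep_invariant[OF \<tau> n] by (rule map_compose[symmetric])
  moreover have "compose V \<tau> \<rho> \<in> Aut N"
    by (rule compose_in_Aut[OF N(1) \<tau> \<rho>(1)])
  moreover have "compose V \<tau> \<rho> (rep (\<tau> n)) = \<tau> n"
    using rep_invariant[OF \<tau> n] rep_mem[OF n] \<rho>(2) by (simp add: compose_eq)
  ultimately show "zs \<in> code_set (\<tau> n)"
    unfolding code_set_def using xy by blast
qed

lemma g_code_set:
  assumes \<tau>: "\<tau> \<in> Aut N" and n: "n \<in> V"
  shows "map (g \<tau>) ` code_set n = code_set (\<tau> n)"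
proof (rule antisym[OF g_code_set_subset[OF assms]])
  obtain \<tau>' where \<tau>': "\<tau>' \<in> Aut N"
    "\<And>n. n \<in> V \<Longrightarrow> \<tau>' (\<tau> n) = n" "\<And>n. n \<in> V \<Longrightarrow> \<tau> (\<tau>' n) = n"
    "\<And>x. x \<in> U \<Longrightarrow> g \<tau>' (g \<tau> x) = x" "\<And>x. x \<in> U \<Longrightarrow> g \<tau> (g \<tau>' x) = x"
    by (rule Aut_N_inverseE[OF \<tau>]) (rule that)
  have \<tau>n: "\<tau> n \<in> V"
    by (rule Aut_mem[OF \<tau> n])
  have "code_set (\<tau> n) = map (compose U (g \<tau>) (g \<tau>')) ` code_set (\<tau> n)"
    by (rule map_image_identity[OF code_set_subset_lists[OF \<tau>n], symmetric])
      (simp add: compose_eq \<tau>'(5))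
  also have "\<dots> = map (g \<tau>) ` map (g \<tau>') ` code_set (\<tau> n)"
    by (rule map_image_compose[OF code_set_subset_lists[OF \<tau>n]])
  also have "\<dots> \<subseteq> map (g \<tau>) ` code_set n"
    using g_code_set_subset[OF \<tau>'(1) \<tau>n] \<tau>'(2)[OF n] by (intro image_mono) simp
  finally show "code_set (\<tau> n) \<subseteq> map (g \<tau>) ` code_set n" .
qed

lemma act_code: "\<tau> \<in> Aut N \<Longrightarrow> n \<in> V \<Longrightarrow> act (g \<tau>) (code n) = code (\<tau> n)"
  by (simp add: code_def act_Pair g_code_set rep_invariant)

text \<open>A common tuple gives two translating elements that agree on the base. Their quotient
  fixes the base, hence the representative by \<open>base_stabilizer\<close>, so both send the
  representative to the same point.\<close>

lemma code_set_disjoint: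
  assumes n: "n \<in> V" and n': "n' \<in> V" and rep: "rep n = rep n'"
    and zs: "zs \<in> code_set n" "zs \<in> code_set n'"
  shows "n = n'"
proof -
  let ?q = "rep n"
  have q: "?q \<in> rep ` V" "?q \<in> V"
    using n rep_mem by auto
  obtain \<tau> x y where \<tau>: "\<tau> \<in> Aut N" "\<tau> ?q = n" "zs = map (g \<tau>) (base ?q @ [x, y])"
    using zs(1) unfolding code_set_def by blast
  obtain \<rho> x' y' where \<rho>: "\<rho> \<in> Aut N" "\<rho> ?q = n'" "zs = map (g \<rho>) (base ?q @ [x', y'])"
    using zs(2) unfolding code_set_def rep by blast
  obtain \<tau>' where \<tau>': "\<tau>' \<in> Aut N"
    "\<And>n. n \<in> V \<Longrightarrow> \<tau>' (\<tau> n) = n" "\<And>n. n \<in> V \<Longrightarrow> \<tau> (\<tau>' n) = n"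
    "\<And>x. x \<in> U \<Longrightarrow> g \<tau>' (g \<tau> x) = x" "\<And>x. x \<in> U \<Longrightarrow> g \<tau> (g \<tau>' x) = x"
    by (rule Aut_N_inverseE[OF \<tau>(1)]) (rule that)
  have comp: "compose V \<tau>' \<rho> \<in> Aut N"
    by (rule compose_in_Aut[OF N(1) \<tau>'(1) \<rho>(1)])
  have "g (compose V \<tau>' \<rho>) b = b" if b: "b \<in> set (base ?q)" for b
  proof -
    have "b \<in> U"
      using b base_subset[OF q(1)] by blast
    moreover have "g \<rho> b = g \<tau> b"
      using \<tau>(3) \<rho>(3) b by simp
    ultimately show ?thesis
      by (simp add: g_compose[OF \<tau>'(1) \<rho>(1)] compose_eq \<tau>'(4))
  qed
  then have "h (g (compose V \<tau>' \<rho>)) ?q = ?q"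
    by (rule base_stabilizer[OF q(1) g_mem[OF comp]])
  then have "\<tau>' n' = ?q"
    using hg[OF comp] q(2) \<rho>(2) by (simp add: compose_eq)
  then show ?thesis
    using \<tau>'(3)[OF n'] \<tau>(2) by simp
qed

lemma code_eq_iff:
  assumes "n \<in> V" "n' \<in> V"
  shows "code n = code n' \<longleftrightarrow> n = n'"
proof
  assume "code n = code n'"
  then show "n = n'"
    using code_set_disjoint[OF assms] code_set_nonempty[OF assms(1)] by (auto simp: code_def)
qed simp

text \<open>Over the parameters only the image of \<open>g\<close> acts, and it permutes pairwise
  disjoint classes within an orbit. For \<open>Aut M\<close> itself the class need not be a block,
  so the image of the interpretation lies in the imaginaries of M/A.\<close>

lemma code_mem_Eq_univ:
  assumes n: "n \<in> V"
  shows "code n \<in> Eq_univ M (fixed_imaginaries :: ('b, 'a) imag set)"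
  unfolding code_def
proof (rule Eq_univI[OF M(1) fixed_imaginaries_subset code_set_nonempty[OF n] code_set_lists[OF n]])
  fix \<sigma> assume "\<sigma> \<in> Aut_over M (fixed_imaginaries :: ('b, 'a) imag set)"
    and meet: "map \<sigma> ` code_set n \<inter> code_set n \<noteq> {}"
  then obtain \<tau> where \<tau>: "\<tau> \<in> Aut N" "\<sigma> = g \<tau>"
    unfolding Aut_over_fixed_imaginaries by blast
  have "map \<sigma> ` code_set n = code_set (\<tau> n)"
    unfolding \<tau>(2) by (rule g_code_set[OF \<tau>(1) n])
  moreover have "\<tau> n = n"
    using meet unfolding calculation
    using code_set_disjoint[OF Aut_mem[OF \<tau>(1) n] n rep_invariant[OF \<tau>(1) n]] by blast
  ultimately show "map \<sigma> ` code_set n = code_set n"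
    by simp
qed

text \<open>
  An automorphism fixing every code agrees on a given finite invariant set with an element of the
  image of \<open>g\<close>: after a correction by that image it fixes a sufficiently long base, and then it
  preserves the ordering of the finite set.
\<close>

lemma fixes_codes_locally_in_range:
  assumes \<rho>: "\<rho> \<in> Aut M" and fixed: "\<And>n. n \<in> V \<Longrightarrow> act \<rho> (code n) = code n"
    and F: "finite F" "F \<subseteq> U"
  shows "\<exists>\<tau>\<in>Aut N. \<forall>x\<in>F. g \<tau> x = \<rho> x"
proof -
  obtain F' where F': "finite F'" "F \<subseteq> F'" "F' \<subseteq> U"
    "\<And>\<sigma> x. \<sigma> \<in> Aut M \<Longrightarrow> x \<in> F' \<Longrightarrow> \<sigma> x \<in> F'"
    by (rule finitary_finite_invariant[OF M F]) (rule that)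
  \<comment> \<open>The base has to control the invariant set \<open>F'\<close>, not merely
    \<open>F\<close>: rigidity will be applied to a permutation of \<open>F'\<close>.\<close>
  obtain q where q: "q \<in> rep ` V" and
    q_cof: "\<And>\<tau> x. \<tau> \<in> Aut N \<Longrightarrow> (\<And>b. b \<in> set (base q) \<Longrightarrow> g \<tau> b = b) \<Longrightarrow> x \<in> F' \<Longrightarrow> g \<tau> x = x"
    using base_cofinal[OF F'(1,3)] by blast
  have qV: "q \<in> V" and rep_q: "rep q = q"
    using subsetD[OF rep_subset q] rep_rep[OF q] by simp_all
  have base_code: "base q @ [x, y] \<in> code_set q" if "x \<in> U" "y \<in> U" "(x, y) \<in> r" for x y
  proof -
    have "map (g (\<lambda>n\<in>V. n)) (base q @ [x, y]) = base q @ [x, y]"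
      by (rule map_idI, rule g_identity[OF id_in_Aut[OF N(1)]])
        (use that base_subset[OF q] in auto)
    moreover have "map (g (\<lambda>n\<in>V. n)) (base q @ [x, y]) \<in> code_set q"
      using code_setI[OF id_in_Aut[OF N(1)] _ that, of q] qV rep_q by simp
    ultimately show ?thesis
      by simp
  qed
  have code_setD: "\<exists>\<tau> x' y'. \<tau> \<in> Aut N \<and> \<tau> q = q \<and> x' \<in> U \<and> y' \<in> U \<and> (x', y') \<in> r \<and>
      zs = map (g \<tau>) (base q @ [x', y'])" if "zs \<in> code_set q" for zs
    using that unfolding code_set_def rep_q by blast
  have \<rho>_code: "map \<rho> ` code_set q = code_set q"
    using fixed[OF qV] by (simp add: code_def act_Pair)
  \<comment> \<open>An arbitrary filler for the last two entries, used to read off how \<rho> moves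
    the base.\<close>
  obtain m where m: "m \<in> U"
    using M(1) by (auto simp: is_structure_def)
  have "map \<rho> (base q @ [m, m]) \<in> code_set q"
    using base_code[OF m m r_refl] \<rho>_code by blast
  then obtain \<tau> where \<tau>: "\<tau> \<in> Aut N" "\<tau> q = q" and "map \<rho> (base q) = map (g \<tau>) (base q)"
    using code_setD by fastforce
  then have \<rho>_base: "\<rho> b = g \<tau> b" if "b \<in> set (base q)" for b
    using that by simp
  obtain \<tau>' where \<tau>': "\<tau>' \<in> Aut N"
    "\<And>n. n \<in> V \<Longrightarrow> \<tau>' (\<tau> n) = n" "\<And>n. n \<in> V \<Longrightarrow> \<tau> (\<tau>' n) = n"
    "\<And>x. x \<in> U \<Longrightarrow> g \<tau>' (g \<tau> x) = x" "\<And>x. x \<in> U \<Longrightarrow> g \<tau> (g \<tau>' x) = x"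
    by (rule Aut_N_inverseE[OF \<tau>(1)]) (rule that)
  define \<delta> where "\<delta> = compose U (g \<tau>') \<rho>"
  have \<delta>: "\<delta> \<in> Aut M"
    unfolding \<delta>_def by (rule compose_in_Aut[OF M(1) g_mem[OF \<tau>'(1)] \<rho>])
  have \<delta>_base: "\<delta> b = b" if "b \<in> set (base q)" for b
    using that base_subset[OF q] \<rho>_base[OF that] \<tau>'(4)[of b] by (auto simp: \<delta>_def compose_eq)
  \<comment> \<open>As \<tau> fixes \<open>q\<close>, the correction by \<open>g \<tau>'\<close>
    maps the class of \<open>q\<close> to itself.\<close>
  have "\<tau>' q = q"
    using \<tau>'(2)[OF qV] \<tau>(2) by simp
  then have \<delta>_code: "map \<delta> ` code_set q = code_set q"
    unfolding \<delta>_def map_image_compose[OF code_set_subset_lists[OF qV]] \<rho>_code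
    using g_code_set[OF \<tau>'(1) qV] by simp
  have \<delta>_mono: "(\<delta> x, \<delta> y) \<in> r" if x: "x \<in> F'" and y: "y \<in> F'" and xy: "(x, y) \<in> r" for x y
  proof -
    have "map \<delta> (base q @ [x, y]) \<in> code_set q"
      using base_code[of x y] \<delta>_code x y xy F'(3) by blast
    then obtain \<kappa> x' y' where \<kappa>: "\<kappa> \<in> Aut N" and xy': "x' \<in> U" "y' \<in> U" "(x', y') \<in> r"
      and eq: "map \<delta> (base q @ [x, y]) = map (g \<kappa>) (base q @ [x', y'])"
      using code_setD by blast
    \<comment> \<open>\<delta> fixes the base, hence so does \<open>g \<kappa>\<close>, and the
      choice of \<open>q\<close> lets it fix \<open>F'\<close> pointwise. The translate is therefore
      invisible on \<open>F'\<close>, and the ordered pair \<open>(x', y')\<close> must be the image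
      of \<open>(x, y)\<close> under \<delta>.\<close>
    have \<kappa>_F': "g \<kappa> z = z" if "z \<in> F'" for z
      by (rule q_cof[OF \<kappa> _ that]) (use eq \<delta>_base in auto)
    have "x' = \<delta> x"
    proof -
      have "\<delta> x \<in> F'"
        by (rule F'(4)[OF \<delta> x])
      then have "g \<kappa> x' = g \<kappa> (\<delta> x)"
        using eq \<kappa>_F' by simp
      then show ?thesis
        using Aut_inj[OF g_mem[OF \<kappa>] xy'(1)] \<open>\<delta> x \<in> F'\<close> F'(3) by blast
    qed
    moreover have "y' = \<delta> y"
    proof -
      have "\<delta> y \<in> F'"
        by (rule F'(4)[OF \<delta> y])
      then have "g \<kappa> y' = g \<kappa> (\<delta> y)"
        using eq \<kappa>_F' by simp
      then show ?thesis
        using Aut_inj[OF g_mem[OF \<kappa>] xy'(2)] \<open>\<delta> y \<in> F'\<close> F'(3) by blast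
    qed
    ultimately show ?thesis
      using xy'(3) by simp
  qed
  have inj: "inj_on \<delta> F'"
    using Aut_inj[OF \<delta>] F'(3) by (meson inj_onI subsetD)
  moreover have "\<delta> ` F' = F'"
    by (rule endo_inj_surj[OF F'(1) _ inj]) (use F'(4)[OF \<delta>] in blast)
  ultimately have \<delta>_F': "\<delta> x = x" if "x \<in> F'" for x
    by (rule monotone_on_well_order_identity[OF r _ _ \<delta>_mono that])
  have "g \<tau> x = \<rho> x" if "x \<in> F" for x
  proof -
    have x: "x \<in> F'" "x \<in> U"
      using that F'(2) F(2) by auto
    then have "g \<tau>' (\<rho> x) = x"
      using \<delta>_F'[OF x(1)] by (simp add: \<delta>_def compose_eq)
    then show ?thesis
      using \<tau>'(5)[OF Aut_mem[OF \<rho> x(2)]] by simp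
  qed
  then show ?thesis
    using \<tau>(1) by blast
qed

section \<open>The bracket of the code map\<close>

text \<open>Dividing \<sigma> by \<open>g \<tau>\<close> leaves an automorphism that fixes every
  code. Locally it agrees with elements of the image of \<open>g\<close>, and it belongs to that
  image because the image is closed.\<close>

lemma Aut_bracket_code: "Aut_bracket N M code = g ` Aut N"
proof
  show "g ` Aut N \<subseteq> Aut_bracket N M code"
    using g_mem act_code by (auto simp: Aut_bracket_def)
  show "Aut_bracket N M code \<subseteq> g ` Aut N"
  proof
    fix \<sigma> assume "\<sigma> \<in> Aut_bracket N M code"
    then obtain \<tau> where \<sigma>: "\<sigma> \<in> Aut M" and \<tau>: "\<tau> \<in> Aut N"
      and eq: "\<And>n. n \<in> V \<Longrightarrow> act \<sigma> (code n) = code (\<tau> n)"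
      by (auto simp: Aut_bracket_def)
    obtain \<tau>' where \<tau>': "\<tau>' \<in> Aut N"
      "\<And>n. n \<in> V \<Longrightarrow> \<tau>' (\<tau> n) = n" "\<And>n. n \<in> V \<Longrightarrow> \<tau> (\<tau>' n) = n"
      "\<And>x. x \<in> U \<Longrightarrow> g \<tau>' (g \<tau> x) = x" "\<And>x. x \<in> U \<Longrightarrow> g \<tau> (g \<tau>' x) = x"
      by (rule Aut_N_inverseE[OF \<tau>]) (rule that)
    let ?\<rho> = "compose U (g \<tau>') \<sigma>"
    have \<rho>: "?\<rho> \<in> Aut M"
      by (rule compose_in_Aut[OF M(1) g_mem[OF \<tau>'(1)] \<sigma>])
    have "act ?\<rho> (code n) = code n" if n: "n \<in> V" for n
      unfolding act_compose[OF code_mem_Eq_univ[OF n]] eq[OF n]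
        act_code[OF \<tau>'(1) Aut_mem[OF \<tau> n]] \<tau>'(2)[OF n] ..
    then have "?\<rho> \<in> g ` Aut N"
      by (intro range_section_closed[OF \<rho>] fixes_codes_locally_in_range[OF \<rho>])
    then obtain \<kappa> where \<kappa>: "\<kappa> \<in> Aut N" "?\<rho> = g \<kappa>"
      by blast
    have "\<sigma> = g (compose V \<tau> \<kappa>)"
    proof (rule Aut_eqI[OF \<sigma> g_mem[OF compose_in_Aut[OF N(1) \<tau> \<kappa>(1)]]])
      fix x assume x: "x \<in> U"
      have "g (compose V \<tau> \<kappa>) x = g \<tau> (g \<tau>' (\<sigma> x))"
        unfolding g_compose[OF \<tau> \<kappa>(1)] \<kappa>(2)[symmetric] using x by (simp add: compose_eq)
      then show "\<sigma> x = g (compose V \<tau> \<kappa>) x"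
        using \<tau>'(5)[OF Aut_mem[OF \<sigma> x]] by simp
    qed
    then show "\<sigma> \<in> g ` Aut N"
      using compose_in_Aut[OF N(1) \<tau> \<kappa>(1)] by blast
  qed
qed

lemma bracket_code: "bracket N M {} code = fixed_imaginaries"
  by (simp add: bracket_def Aut_bracket_code fixed_imaginaries_def)

text \<open>Distinct points have distinct codes, so \<open>Aut N\<close> acts faithfully on the
  codes. This gives surjectivity of the interpretation.\<close>

lemma fixes_codes_identity:
  assumes \<tau>: "\<tau> \<in> Aut N" and fixed: "\<And>n. n \<in> V \<Longrightarrow> act (g \<tau>) (code n) = code n" and x: "x \<in> U"
  shows "g \<tau> x = x"
proof -
  have "\<tau> n = n" if "n \<in> V" for n
    using fixed[OF that] act_code[OF \<tau> that] code_eq_iff[OF Aut_mem[OF \<tau> that] that] by simp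
  then show ?thesis
    by (rule g_identity[OF \<tau> _ x])
qed

section \<open>Interpretation, embedding and surjection over the fixed imaginaries\<close>

lemma definable_Eq_code:
  assumes R: "R \<subseteq> lists V" and inv: "\<And>\<tau>. \<tau> \<in> Aut N \<Longrightarrow> map \<tau> ` R = R"
  shows "definable_Eq M (fixed_imaginaries :: ('b, 'a) imag set) (map code ` R)"
  unfolding definable_Eq_def Aut_over_fixed_imaginaries
proof
  fix \<sigma> assume "\<sigma> \<in> g ` Aut N"
  then obtain \<tau> where \<tau>: "\<tau> \<in> Aut N" "\<sigma> = g \<tau>"
    by blast
  have "map (act (g \<tau>)) ` map code ` R = map code ` map \<tau> ` R"
    unfolding image_image
    by (intro image_cong refl) (use R act_code[OF \<tau>(1)] in auto)
  then show "map (act \<sigma>) ` map code ` R = map code ` R"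
    using inv[OF \<tau>(1)] \<tau>(2) by simp
qed

lemma interpretation_code:
  "interpretation_over N M (fixed_imaginaries :: ('b, 'a) imag set) code"
  unfolding interpretation_over_def
proof (intro conjI ballI)
  show "inj_on code V"
    using code_eq_iff by (auto simp: inj_on_def)
  show "code ` V \<subseteq> Eq_univ M fixed_imaginaries"
    using code_mem_Eq_univ by blast
  \<comment> \<open>Invariant sets of points are treated as unary relations, so that sorts and
    universe fall under \<open>definable_Eq_code\<close>.\<close>
  have singletons: "definable_Eq M (fixed_imaginaries :: ('b, 'a) imag set) {[code n] | n. n \<in> S}"
    if S: "S \<subseteq> V" "\<And>\<tau>. \<tau> \<in> Aut N \<Longrightarrow> \<tau> ` S = S" for S
  proof -
    have "definable_Eq M (fixed_imaginaries :: ('b, 'a) imag set) (map code ` (\<lambda>n. [n]) ` S)"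
    proof (rule definable_Eq_code)
      show "(\<lambda>n. [n]) ` S \<subseteq> lists V"
        using S(1) by auto
      fix \<tau> assume \<tau>: "\<tau> \<in> Aut N"
      have "map \<tau> ` (\<lambda>n. [n]) ` S = (\<lambda>n. [n]) ` \<tau> ` S"
        by (simp add: image_image)
      then show "map \<tau> ` (\<lambda>n. [n]) ` S = (\<lambda>n. [n]) ` S"
        using S(2)[OF \<tau>] by simp
    qed
    moreover have "map code ` (\<lambda>n. [n]) ` S = {[code n] | n. n \<in> S}"
      unfolding image_image by auto
    ultimately show ?thesis
      by simp
  qed
  show "definable_Eq M (fixed_imaginaries :: ('b, 'a) imag set) {[code n] | n. n \<in> V}"
    by (rule singletons) (auto simp: Aut_bij_betw bij_betw_imp_surj_on)
  show "definable_Eq M (fixed_imaginaries :: ('b, 'a) imag set) {[code n] | n. n \<in> sort_set N s}"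
    if "s \<in> sorts N" for s
  proof (rule singletons)
    show "sort_set N s \<subseteq> V"
      using that by (auto simp: universe_def)
  qed (rule AutD(2)[OF _ that])
  show "definable_Eq M (fixed_imaginaries :: ('b, 'a) imag set) (map code ` rel_int N s)"
    if "s \<in> rels N" for s
    by (rule definable_Eq_code[OF rel_int_subset_lists[OF N(1) that] AutD(4)]) (use that in auto)
  show "definable_Eq M (fixed_imaginaries :: ('b, 'a) imag set) (map code ` fun_graph N f)"
    if f: "f \<in> funs N" for f
  proof (rule definable_Eq_code)
    note dom = is_structure_fun(1)[OF N(1) f]
    have val: "fun_int N f xs \<in> V" if "xs \<in> sort_prod N (fun_dom N f)" for xs
      using is_structure_fun(2,3)[OF N(1) f] that by (auto simp: universe_def)
    show "fun_graph N f \<subseteq> lists V"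
    proof
      fix zs assume "zs \<in> fun_graph N f"
      then obtain xs where "xs \<in> sort_prod N (fun_dom N f)" "zs = xs @ [fun_int N f xs]"
        by (auto simp: fun_graph_def)
      then show "zs \<in> lists V"
        using val[of xs] subsetD[OF sort_prod_subset_lists[OF dom], of xs] by simp
    qed
    have sub: "map \<tau> ` fun_graph N f \<subseteq> fun_graph N f" if \<tau>: "\<tau> \<in> Aut N" for \<tau>
    proof
      fix zs assume "zs \<in> map \<tau> ` fun_graph N f"
      then obtain xs where xs: "xs \<in> sort_prod N (fun_dom N f)"
        and zs: "zs = map \<tau> xs @ [\<tau> (fun_int N f xs)]"
        by (auto simp: fun_graph_def)
      have "map \<tau> xs \<in> sort_prod N (fun_dom N f)"
        by (rule sort_prod_map[OF dom _ xs]) (simp add: AutD(2)[OF \<tau>])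
      then show "zs \<in> fun_graph N f"
        unfolding zs AutD(3)[OF \<tau> f xs] fun_graph_def by blast
    qed
    fix \<tau> assume \<tau>: "\<tau> \<in> Aut N"
    show "map \<tau> ` fun_graph N f = fun_graph N f"
    proof (rule antisym[OF sub[OF \<tau>]])
      obtain \<tau>' where \<tau>': "\<tau>' \<in> Aut N" "\<And>n. n \<in> V \<Longrightarrow> \<tau>' (\<tau> n) = n"
        "\<And>n. n \<in> V \<Longrightarrow> \<tau> (\<tau>' n) = n"
        by (rule Aut_inverseE[OF N(1) \<tau>]) (rule that)
      have "fun_graph N f = map (compose V \<tau> \<tau>') ` fun_graph N f"
        by (rule map_image_identity[OF \<open>fun_graph N f \<subseteq> lists V\<close>, symmetric])
          (simp add: compose_eq \<tau>'(3))
      also have "\<dots> = map \<tau> ` map \<tau>' ` fun_graph N f"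
        by (rule map_image_compose[OF \<open>fun_graph N f \<subseteq> lists V\<close>])
      also have "\<dots> \<subseteq> map \<tau> ` fun_graph N f"
        by (rule image_mono[OF sub[OF \<tau>'(1)]])
      finally show "fun_graph N f \<subseteq> map \<tau> ` fun_graph N f" .
    qed
  qed
qed

text \<open>Every \<tau> in \<open>Aut N\<close> is induced on the codes by the automorphism
  \<open>g \<tau>\<close> over the parameters. Invariance of the image of \<open>R\<close> thus
  passes back to \<open>R\<close> through the injective \<open>code\<close>.\<close>

lemma embedding_code: "embedding_over N M (fixed_imaginaries :: ('b, 'a) imag set) code"
  unfolding embedding_over_def
proof (intro conjI allI impI ballI interpretation_code)
  fix k R \<tau>
  assume R: "R \<subseteq> {xs. set xs \<subseteq> V \<and> length xs = k}"
    and def: "definable_Eq M (fixed_imaginaries :: ('b, 'a) imag set) (map code ` R)"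
    and \<tau>: "\<tau> \<in> Aut N"
  have R_lists: "R \<subseteq> lists V"
    using R by auto
  have "map code ` map \<tau> ` R = map (act (g \<tau>)) ` map code ` R"
    unfolding image_image
    by (intro image_cong refl) (use R_lists act_code[OF \<tau>] in auto)
  also have "\<dots> = map code ` R"
    using def \<tau> unfolding definable_Eq_def Aut_over_fixed_imaginaries by blast
  finally have "map code ` map \<tau> ` R = map code ` R" .
  moreover have "inj_on (map code) (lists V)"
    using code_eq_iff by (intro inj_on_map_lists) (auto simp: inj_on_def)
  moreover have "map \<tau> ` R \<subseteq> lists V"
    by (auto dest!: subsetD[OF R_lists] simp: Aut_mem[OF \<tau>])
  ultimately show "map \<tau> ` R = R"
    using R_lists by (simp add: inj_on_image_eq_iff)
qed

lemma real_elements_subset_Eq_univ: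
  assumes "A \<subseteq> Eq_univ M {}"
  shows "real_elements M \<subseteq> Eq_univ M A"
proof -
  have "(l, {[m]}) \<in> Eq_univ M A" if "m \<in> U" for l m
    by (rule Eq_univI[OF M(1) assms, where k = 1]) (use that in auto)
  then show ?thesis
    by (auto simp: real_elements_def)
qed

lemma surjection_code: "surjection_over N M (fixed_imaginaries :: ('b, 'a) imag set) code"
proof -
  have "act \<sigma> a = a" if a: "a \<in> real_elements M"
    and "\<sigma> \<in> Aut_over M (fixed_imaginaries :: ('b, 'a) imag set)" "\<forall>x\<in>code ` V. act \<sigma> x = x"
  for \<sigma> and a :: "('b, 'a) imag"
  proof (rule act_identity[of a M "{}"])
    show "a \<in> Eq_univ M {}"
      using real_elements_subset_Eq_univ a by blast
    fix x assume "x \<in> U"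
    then show "\<sigma> x = x"
      using that(2,3) fixes_codes_identity unfolding Aut_over_fixed_imaginaries by blast
  qed
  then show ?thesis
    using interpretation_code real_elements_subset_Eq_univ[OF fixed_imaginaries_subset]
    by (auto simp: surjection_over_def dcl_Eq_def)
qed

text \<open>The group defining the bracket is the image of \<open>g\<close>, which acts on codes as
  \<open>Aut N\<close> acts on points; fixed codes correspond to fixed points.\<close>

lemma bracket_inter_code:
  "bracket N M (fixed_imaginaries :: ('b, 'a) imag set) code \<inter> code ` V = code ` dcl N {}"
proof -
  have "code n \<in> bracket N M (fixed_imaginaries :: ('b, 'a) imag set) code \<longleftrightarrow> n \<in> dcl N {}"
    if n: "n \<in> V" for n
  proof -
    have "act (g \<tau>) (code n) = code n \<longleftrightarrow> \<tau> n = n" if "\<tau> \<in> Aut N" for \<tau>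
      using act_code[OF that n] code_eq_iff[OF Aut_mem[OF that n] n] by simp
    then show ?thesis
      using n code_mem_Eq_univ[OF n] by (auto simp: bracket_def Aut_bracket_code dcl_def)
  qed
  moreover have "dcl N {} \<subseteq> V"
    by (auto simp: dcl_def)
  ultimately show ?thesis
    by blast
qed

text \<open>An automorphism of \<open>M\<close> fixing \<open>fixed_imaginaries\<close> pointwise is
  one over these parameters, so surjectivity over them applies.\<close>

lemma real_elements_subset_dcl_code:
  "real_elements M \<subseteq> dcl_Eq M {} (code ` V \<union> fixed_imaginaries)"
proof
  fix a :: "('b, 'a) imag" assume a: "a \<in> real_elements M"
  have "act \<sigma> a = a" if "\<sigma> \<in> Aut M" "\<forall>x\<in>code ` V \<union> fixed_imaginaries. act \<sigma> x = x" for \<sigma>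
  proof -
    have "\<sigma> \<in> Aut_over M (fixed_imaginaries :: ('b, 'a) imag set)"
      using that by (auto simp: Aut_over_def)
    then show ?thesis
      using surjection_code a that(2) by (auto simp: surjection_over_def dcl_Eq_def)
  qed
  moreover have "a \<in> Eq_univ M {}"
    using real_elements_subset_Eq_univ a by blast
  ultimately show "a \<in> dcl_Eq M {} (code ` V \<union> fixed_imaginaries)"
    by (auto simp: dcl_Eq_def Aut_over_empty)
qed

end

section \<open>Existence of representatives, bases and the ordering\<close>

lemma (in split_morphism) coding_exists:
  obtains rep base r where "coding N M h g rep base r"
proof -
  define orb where "orb n = {\<tau> n | \<tau>. \<tau> \<in> Aut N}" for n
  \<comment> \<open>The choice depends on the orbit as a set only, so equal orbits have equal
    representatives.\<close>
  define rep where "rep n = (SOME m. m \<in> orb n)" for n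
  have orb_self: "n \<in> orb n" if n: "n \<in> V" for n
  proof -
    have "n = (\<lambda>n\<in>V. n) n"
      using n by simp
    then show ?thesis
      using id_in_Aut[OF N(1)] unfolding orb_def by blast
  qed
  have orb_subset: "orb n \<subseteq> V" if "n \<in> V" for n
    using Aut_mem that by (auto simp: orb_def)
  have orb_invariant: "orb (\<tau> n) = orb n" if \<tau>: "\<tau> \<in> Aut N" and n: "n \<in> V" for \<tau> n
  proof -
    have sub: "orb (\<tau> n) \<subseteq> orb n" if \<tau>: "\<tau> \<in> Aut N" and n: "n \<in> V" for \<tau> n
    proof
      fix m assume "m \<in> orb (\<tau> n)"
      then obtain \<rho> where "\<rho> \<in> Aut N" "m = \<rho> (\<tau> n)"
        by (auto simp: orb_def)
      then have "compose V \<rho> \<tau> \<in> Aut N" "m = compose V \<rho> \<tau> n"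
        using compose_in_Aut[OF N(1) _ \<tau>] n by (auto simp: compose_eq)
      then show "m \<in> orb n"
        by (auto simp: orb_def)
    qed
    obtain \<tau>' where "\<tau>' \<in> Aut N" "\<And>n. n \<in> V \<Longrightarrow> \<tau>' (\<tau> n) = n" "\<And>n. n \<in> V \<Longrightarrow> \<tau> (\<tau>' n) = n"
      by (rule Aut_inverseE[OF N(1) \<tau>]) (rule that)
    then show ?thesis
      using sub[OF \<tau> n] sub[of \<tau>' "\<tau> n"] Aut_mem[OF \<tau> n] n by force
  qed
  have rep_in_orb: "rep n \<in> orb n" if "n \<in> V" for n
    unfolding rep_def using orb_self[OF that] by (rule someI)
  have rep_mem: "rep n \<in> V" if "n \<in> V" for n
    using rep_in_orb orb_subset that by blast
  have rep_orbit: "\<exists>\<tau>\<in>Aut N. \<tau> (rep n) = n" if n: "n \<in> V" for n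
  proof -
    obtain \<tau> where \<tau>: "\<tau> \<in> Aut N" "rep n = \<tau> n"
      using rep_in_orb[OF n] by (auto simp: orb_def)
    then have "n \<in> orb (rep n)"
      using orb_invariant[OF \<tau>(1) n] orb_self[OF n] by simp
    then show ?thesis
      unfolding orb_def by (auto simp: eq_commute[of n])
  qed
  have finite_orb: "finite (orb n)" if "n \<in> V" for n
  proof -
    have n: "finite {n}" "{n} \<subseteq> V"
      using that by auto
    obtain F' where F': "finite F'" "{n} \<subseteq> F'" "F' \<subseteq> V"
      "\<And>\<sigma> x. \<sigma> \<in> Aut N \<Longrightarrow> x \<in> F' \<Longrightarrow> \<sigma> x \<in> F'"
      by (rule finitary_finite_invariant[OF N n]) (rule that)
    have "orb n \<subseteq> F'"
      using F'(2,4) by (auto simp: orb_def)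
    then show ?thesis
      using F'(1) by (rule finite_subset)
  qed
  have cover: "(\<Union>q\<in>rep ` V. orb q) = V"
  proof
    show "(\<Union>q\<in>rep ` V. orb q) \<subseteq> V"
      using orb_subset rep_mem by blast
    show "V \<subseteq> (\<Union>q\<in>rep ` V. orb q)"
    proof
      fix n assume n: "n \<in> V"
      obtain \<tau> where "\<tau> \<in> Aut N" "n = \<tau> (rep n)"
        using rep_orbit[OF n] by metis
      then have "n \<in> orb (rep n)"
        unfolding orb_def by blast
      then show "n \<in> (\<Union>q\<in>rep ` V. orb q)"
        using n by blast
    qed
  qed
  have "rep ` V \<noteq> {}"
    using N(1) by (simp add: is_structure_def)
  moreover have "finite (orb q)" if "q \<in> rep ` V" for q
    using that finite_orb rep_mem by blast
  \<comment> \<open>The indices are representatives because the base may depend only on the orbit.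
    Orbits are finite and cover \<open>V\<close>, so the sets \<open>e q\<close> are cofinal among
    the finite subsets of \<open>V\<close>.\<close>
  ultimately obtain e where e: "\<And>q. q \<in> rep ` V \<Longrightarrow> finite (e q)"
    "\<And>q. q \<in> rep ` V \<Longrightarrow> e q \<subseteq> (\<Union>q\<in>rep ` V. orb q)"
    "\<And>Z. finite Z \<Longrightarrow> Z \<subseteq> (\<Union>q\<in>rep ` V. orb q) \<Longrightarrow> \<exists>q\<in>rep ` V. Z \<subseteq> e q"
    by (rule cofinal_finite_sets) (assumption, rule that)
  \<comment> \<open>Continuity of \<open>h\<close> at the identity provides the base. The point
    \<open>q\<close> is included for \<open>base_stabilizer\<close>, the set \<open>e q\<close> for
    \<open>base_cofinal\<close>.\<close>
  have "\<exists>xs. set xs \<subseteq> U \<and> (\<forall>\<sigma>\<in>Aut M. (\<forall>x\<in>set xs. \<sigma> x = x) \<longrightarrow> (\<forall>n\<in>insert q (e q). h \<sigma> n = n))"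
    if q: "q \<in> rep ` V" for q
  proof -
    have cont: "continuous_map (Aut_topology M) (Aut_topology N) h"
      using h by (simp add: Aut_morphism_def)
    obtain F where F: "finite F" "F \<subseteq> U"
      "\<And>\<sigma> n. \<sigma> \<in> Aut M \<Longrightarrow> (\<forall>x\<in>F. \<sigma> x = (\<lambda>x\<in>U. x) x) \<Longrightarrow> n \<in> insert q (e q) \<Longrightarrow>
        h \<sigma> n = h (\<lambda>x\<in>U. x) n"
      by (rule continuous_map_Aut_topologyD[OF cont id_in_Aut[OF M(1)], of "insert q (e q)"])
        (use e(1)[OF q] in simp, rule that)
    have "insert q (e q) \<subseteq> V"
      using q e(2)[OF q] cover rep_mem by blast
    then have "h \<sigma> n = n"
      if "\<sigma> \<in> Aut M" "\<And>x. x \<in> F \<Longrightarrow> \<sigma> x = x" "n \<in> insert q (e q)" for \<sigma> n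
      using F(3)[OF that(1) _ that(3)] that(2,3) F(2) Aut_morphism_id[OF M(1) N(1) h]
      by (auto simp: subset_iff)
    moreover obtain xs where "set xs = F"
      using finite_list[OF F(1)] by blast
    ultimately show ?thesis
      using F(2) by blast
  qed
  then obtain base where base: "\<And>q. q \<in> rep ` V \<Longrightarrow> set (base q) \<subseteq> U"
    "\<And>q \<sigma> n. q \<in> rep ` V \<Longrightarrow> \<sigma> \<in> Aut M \<Longrightarrow> (\<forall>x\<in>set (base q). \<sigma> x = x) \<Longrightarrow>
      n \<in> insert q (e q) \<Longrightarrow> h \<sigma> n = n"
    by metis
  obtain r :: "'a rel" where r: "well_order_on UNIV r"
    using well_order_on by blast
  have "coding N M h g rep base r"
  proof unfold_locales
    show "rep (\<tau> n) = rep n" if "\<tau> \<in> Aut N" "n \<in> V" for \<tau> n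
      by (simp add: rep_def orb_invariant[OF that])
    show "h \<sigma> q = q" if "q \<in> rep ` V" "\<sigma> \<in> Aut M" "\<And>x. x \<in> set (base q) \<Longrightarrow> \<sigma> x = x" for q \<sigma>
      using base(2) that by blast
    show "\<exists>q\<in>rep ` V. \<forall>\<tau>\<in>Aut N. (\<forall>x\<in>set (base q). g \<tau> x = x) \<longrightarrow> (\<forall>x\<in>F. g \<tau> x = x)"
      if F: "finite F" "F \<subseteq> U" for F
    proof -
      have cont: "continuous_map (Aut_topology N) (Aut_topology M) g"
        using g by (simp add: Aut_morphism_def)
      \<comment> \<open>Continuity of \<open>g\<close> at the identity reduces fixing
        \<open>F\<close> in \<open>M\<close> to fixing a finite set in \<open>N\<close>, which some
        \<open>e q\<close> contains.\<close>
      obtain Z where Z: "finite Z" "Z \<subseteq> V"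
        "\<And>\<tau> x. \<tau> \<in> Aut N \<Longrightarrow> (\<forall>n\<in>Z. \<tau> n = (\<lambda>n\<in>V. n) n) \<Longrightarrow> x \<in> F \<Longrightarrow>
          g \<tau> x = g (\<lambda>n\<in>V. n) x"
        by (rule continuous_map_Aut_topologyD[OF cont id_in_Aut[OF N(1)] F(1)]) (rule that)
      obtain q where q: "q \<in> rep ` V" "Z \<subseteq> e q"
        using e(3)[of Z] Z(1,2) cover by auto
      have "g \<tau> x = x" if \<tau>: "\<tau> \<in> Aut N" and fixed: "\<forall>x\<in>set (base q). g \<tau> x = x" and x: "x \<in> F" for \<tau> x
      proof -
        \<comment> \<open>The base controls \<open>h (g \<tau>)\<close>, which is \<tau> because
          \<open>g\<close> is a section.\<close>
        have "\<tau> n = n" if "n \<in> Z" for n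
          using base(2)[OF q(1) g_mem[OF \<tau>] fixed, of n] that q(2) hg[OF \<tau>] by auto
        then have "g \<tau> x = g (\<lambda>n\<in>V. n) x"
          using Z(2) by (intro Z(3)[OF \<tau> _ x]) auto
        then show ?thesis
          using x F(2) Aut_morphism_id[OF N(1) M(1) g] by auto
      qed
      then show ?thesis
        using q(1) by blast
    qed
  qed (use rep_mem rep_orbit base(1) r in auto)
  then show thesis
    by (rule that)
qed

theorem mainTheorem2:
  fixes N :: "('t, 'g, 'q, 'b) mstruct"
    and M :: "('s, 'f, 'r, 'a) mstruct"
    and h :: "('a \<Rightarrow> 'a) \<Rightarrow> ('b \<Rightarrow> 'b)"
    and g :: "('b \<Rightarrow> 'b) \<Rightarrow> ('a \<Rightarrow> 'a)"
  assumes "is_structure N" and "finitary N"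
    and "is_structure M" and "finitary M"
    and "Aut_morphism M N h" and "h ` Aut M = Aut N"
    and "Aut_morphism N M g" and "\<forall>\<tau>\<in>Aut N. h (g \<tau>) = \<tau>"
  shows "\<exists>(A :: ('b, 'a) imag set) (i :: 'b \<Rightarrow> ('b, 'a) imag).
    A \<subseteq> Eq_univ M {} \<and>
    isomorphism_over N M A i \<and>
    dcl_Eq M {} A = dcl_Eq M {} (bracket N M {} i) \<and>
    isomorphism_over N M (bracket N M {} i) i \<and>
    real_elements M \<subseteq> dcl_Eq M {} (i ` universe N \<union> bracket N M {} i) \<and>
    bracket N M A i \<inter> i ` universe N = i ` dcl N {}"
proof -
  interpret split_morphism N M h g
    by unfold_locales (use assms in auto)
  obtain rep base r where "coding N M h g rep base r"
    by (rule coding_exists)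
  then interpret coding N M h g rep base r .
  have "isomorphism_over N M (fixed_imaginaries :: ('b, 'a) imag set) code"
    using embedding_code surjection_code by (simp add: isomorphism_over_def)
  \<comment> \<open>By \<open>bracket_code\<close> the parameter set is the bracket itself, so the
    equality of closures is trivial and both isomorphism claims coincide.\<close>
  then show ?thesis
    using fixed_imaginaries_subset real_elements_subset_dcl_code bracket_inter_code
    by (intro exI[of _ fixed_imaginaries] exI[of _ code]) (simp add: bracket_code)
qed

end
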